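(* Let $\alpha>0$ and let $n\ge1$ be an integer. Let $\tau=\tau(t)$ be the Jimbo–Miwa–Ueno isomonodromy $\tau$-function (defined up to a constant factor) of the linear system associated in the context with the weight $x^\alpha e^{-x-s/x}$, where $t=\sqrt{s}$. Then there is a constant $C$, independent of $s$, such that for all $s>0$ $$D_n(s)=C\,\tau(\sqrt{s})\,e^{s/2}\,s^{\frac{n(n+\alpha)}{2}}.$$
   Context: Orthogonal polynomials. Fix $\alpha>0$. For $s>0$ let $w(x,s)=x^{\alpha}e^{-x-s/x}$ on $(0,\infty)$, let $P_n(x)=P_n(x,s)$ be the monic polynomials of degree $n$ with $\int_0^\infty P_jP_k\,w\,dx=h_j(s)\delta_{jk}$, and let $$D_n(s)=\det\left(\int_0^\infty x^{j+k}w(x,s)\,dx\right)_{j,k=0}^{n-1}=\prod_{j=0}^{n-1}h_j(s).$$ For $n\ge1$ put $$p_n=\frac{P_n(0)}{2\pi i}\int_0^\infty\frac{P_n(x)}{x}w(x,s)\,dx,\qquad q_n=\frac{2\pi i}{h_{n-1}}\frac{P_{n-1}(0)}{P_n(0)}.$$ Linear system. Let $t=\sqrt s$, $\theta_\infty=-\alpha-2n$, $\theta_0=\alpha$, and $$u=-\frac{h_n}{2\pi i}t^{-2n-\alpha},\quad v=\frac{2\pi i}{h_{n-1}}t^{2n+\alpha},\quad \zeta=-t\,p_nq_n,\quad \omega=-\frac{1}{q_n}t^{-2n-\alpha},$$ all regarded as functions of $t$ (with $s=t^2$). Let $\sigma_3=\mathrm{diag}(1,-1)$ and consider $$\frac{\partial\Phi}{\partial\lambda}=\left(-\frac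 t2\sigma_3+\frac{A_{-1}}{\lambda}+\frac{A_{-2}}{\lambda^2}\right)\Phi,\qquad A_{-1}=\begin{pmatrix}-\frac{\theta_\infty}{2}&u\\ v&\frac{\theta_\infty}{2}\end{pmatrix},\quad A_{-2}=\begin{pmatrix}\zeta+\frac t2&-\omega\zeta\\ \frac{\zeta+t}{\omega}&-\zeta-\frac t2\end{pmatrix}.$$ This equation has formal matrix solutions at $\lambda=\infty$ and $\lambda=0$ of the form $$\hat Y_\infty(\lambda)\,\lambda^{-\frac{\theta_\infty}{2}\sigma_3}e^{-\frac{t\lambda}{2}\sigma_3},\quad \hat Y_\infty(\lambda)=I+\sum_{k\ge1}\Phi^{(\infty)}_k\lambda^{-k},$$ $$R^{(0)}\hat Y_0(\lambda)\,\lambda^{\frac{\theta_0}{2}\sigma_3}e^{-\frac{t}{2\lambda}\sigma_3},\quad \hat Y_0(\lambda)=I+\sum_{k\ge1}\Phi^{(0)}_k\lambda^{k},$$ where $\det R^{(0)}=1$ and $\frac t2R^{(0)}\sigma_3(R^{(0)})^{-1}=A_{-2}$ ($R^{(0)}$ is determined up to a right diagonal factor, which does not affect what follows). $\tau$-function. It is defined, up to a multiplicative constant, by $$d\ln\tau=-\mathrm{Trace}\,\mathrm{Res}_{\lambda=0}\,\hat Y_0^{-1}\frac{\partial\hat Y_0}{\partial\lambda}\,dT_0-\mathrm{Trace}\,\mathrm{Res}_{\lambda=\infty}\,\hat Y_\infty^{-1}\frac{\partial\hat Y_\infty}{\partial\lambda}\,dT_\infty,$$ with $dT_0=-\frac{1}{2\lambda}\sigma_3\,dt$,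 $dT_\infty=-\frac{\lambda}{2}\sigma_3\,dt$, where $\mathrm{Res}_{\lambda=\infty}$ is minus the coefficient of $\lambda^{-1}$; equivalently $$\frac{d\ln\tau}{dt}=\frac12\mathrm{Trace}\left(\Phi^{(0)}_1\sigma_3+\Phi^{(\infty)}_1\sigma_3\right).$$ *)

theory Defs
  imports
    "HOL-Analysis.Analysis"
    "HOL-Computational_Algebra.Computational_Algebra"
    "Jordan_Normal_Form.Determinant"
begin

section \<open>Orthogonal polynomials\<close>

definition weight :: "real \<Rightarrow> real \<Rightarrow> real \<Rightarrow> real" where
  "weight \<alpha> s x = x powr \<alpha> * exp (- x - s / x)"

definition weighted_integral :: "real \<Rightarrow> real \<Rightarrow> (real \<Rightarrow> real) \<Rightarrow> real" where
  "weighted_integral \<alpha> s f = (LBINT x:{0<..}. f x * weight \<alpha> s x)"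

definition monic_orthogonal_system :: "real \<Rightarrow> real \<Rightarrow> (nat \<Rightarrow> real poly) \<Rightarrow> bool" where
  "monic_orthogonal_system \<alpha> s P \<longleftrightarrow>
     (\<forall>j. degree (P j) = j \<and> lead_coeff (P j) = 1) \<and>
     (\<forall>j k. j \<noteq> k \<longrightarrow> weighted_integral \<alpha> s (\<lambda>x. poly (P j) x * poly (P k) x) = 0)"

definition orth_poly :: "real \<Rightarrow> real \<Rightarrow> nat \<Rightarrow> real poly" where
  "orth_poly \<alpha> s = (THE P. monic_orthogonal_system \<alpha> s P)"

definition sq_norm_h :: "real \<Rightarrow> real \<Rightarrow> nat \<Rightarrow> real" where
  "sq_norm_h \<alpha> s j = weighted_integral \<alpha> s (\<lambda>x. (poly (orth_poly \<alpha> s j) x)\<^sup>2)"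

definition hankel_det :: "real \<Rightarrow> real \<Rightarrow> nat \<Rightarrow> real" where
  "hankel_det \<alpha> s n =
     Determinant.det (Matrix.mat n n (\<lambda>(j, k). weighted_integral \<alpha> s (\<lambda>x. x ^ (j + k))))"

definition p_fun :: "real \<Rightarrow> real \<Rightarrow> nat \<Rightarrow> complex" where
  "p_fun \<alpha> s n =
     of_real (poly (orth_poly \<alpha> s n) 0) / (2 * of_real pi * \<i>) *
     of_real (weighted_integral \<alpha> s (\<lambda>x. poly (orth_poly \<alpha> s n) x / x))"

definition q_fun :: "real \<Rightarrow> real \<Rightarrow> nat \<Rightarrow> complex" where
  "q_fun \<alpha> s n =
     2 * of_real pi * \<i> / of_real (sq_norm_h \<alpha> s (n - 1)) *
     of_real (poly (orth_poly \<alpha> s (n - 1)) 0 / poly (orth_poly \<alpha> s n) 0)"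

section \<open>The linear system\<close>

definition mat22 :: "'a \<Rightarrow> 'a \<Rightarrow> 'a \<Rightarrow> 'a \<Rightarrow> 'a::zero ^ 2 ^ 2" where
  "mat22 a b c d = vector [vector [a, b], vector [c, d]]"

text \<open>The multiple \<open>c \<sigma>\<^sub>3\<close> of the Pauli matrix \<open>\<sigma>\<^sub>3 = diag(1, -1)\<close>.\<close>

definition sigma3_mult :: "'a \<Rightarrow> 'a::ring_1 ^ 2 ^ 2" where
  "sigma3_mult c = mat22 c 0 0 (- c)"

definition theta_inf :: "real \<Rightarrow> nat \<Rightarrow> real" where
  "theta_inf \<alpha> n = - \<alpha> - 2 * real n"

definition theta_zero :: "real \<Rightarrow> real" where
  "theta_zero \<alpha> = \<alpha>"

definition u_fun :: "real \<Rightarrow> nat \<Rightarrow> real \<Rightarrow> complex" where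
  "u_fun \<alpha> n t =
     - (of_real (sq_norm_h \<alpha> (t\<^sup>2) n) / (2 * of_real pi * \<i>)) * of_real (t powr (- 2 * real n - \<alpha>))"

definition v_fun :: "real \<Rightarrow> nat \<Rightarrow> real \<Rightarrow> complex" where
  "v_fun \<alpha> n t =
     2 * of_real pi * \<i> / of_real (sq_norm_h \<alpha> (t\<^sup>2) (n - 1)) * of_real (t powr (2 * real n + \<alpha>))"

definition zeta_fun :: "real \<Rightarrow> nat \<Rightarrow> real \<Rightarrow> complex" where
  "zeta_fun \<alpha> n t = - of_real t * p_fun \<alpha> (t\<^sup>2) n * q_fun \<alpha> (t\<^sup>2) n"

definition omega_fun :: "real \<Rightarrow> nat \<Rightarrow> real \<Rightarrow> complex" where
  "omega_fun \<alpha> n t = - (1 / q_fun \<alpha> (t\<^sup>2) n) * of_real (t powr (- 2 * real n - \<alpha>))"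

definition A_minus1 :: "real \<Rightarrow> nat \<Rightarrow> real \<Rightarrow> complex ^ 2 ^ 2" where
  "A_minus1 \<alpha> n t =
     mat22 (of_real (- theta_inf \<alpha> n / 2)) (u_fun \<alpha> n t)
           (v_fun \<alpha> n t)                   (of_real (theta_inf \<alpha> n / 2))"

definition A_minus2 :: "real \<Rightarrow> nat \<Rightarrow> real \<Rightarrow> complex ^ 2 ^ 2" where
  "A_minus2 \<alpha> n t =
     (let \<zeta> = zeta_fun \<alpha> n t; \<omega> = omega_fun \<alpha> n t; t' = complex_of_real t in
       mat22 (\<zeta> + t' / 2)     (- \<omega> * \<zeta>)
             ((\<zeta> + t') / \<omega>)  (- \<zeta> - t' / 2))"

text \<open>
  The spectral parameter is kept as an argument, so that the same expression can be expanded in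
  the local coordinate \<open>z = \<lambda>\<close> at \<open>\<lambda> = 0\<close> and in \<open>z = 1/\<lambda>\<close> at \<open>\<lambda> = \<infinity>\<close>.  In both cases formal
  expansions live in \<^typ>\<open>complex fls\<close>, whose indeterminate \<^const>\<open>fls_X\<close> is \<open>z\<close>.
\<close>

definition lax_matrix :: "real \<Rightarrow> nat \<Rightarrow> real \<Rightarrow> complex fls \<Rightarrow> complex fls ^ 2 ^ 2" where
  "lax_matrix \<alpha> n t lam =
     sigma3_mult (fls_const (- of_real t / 2)) +
     map_matrix (\<lambda>a. fls_const a / lam) (A_minus1 \<alpha> n t) +
     map_matrix (\<lambda>a. fls_const a / lam ^ 2) (A_minus2 \<alpha> n t)"

definition lam_zero :: "complex fls" where "lam_zero = fls_X"
definition lam_inf :: "complex fls" where "lam_inf = fls_X_inv"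

text \<open>Differentiation with respect to \<open>\<lambda>\<close>; for \<open>z = 1/\<lambda>\<close> one has \<open>d/d\<lambda> = -z\<^sup>2 d/dz\<close>.\<close>

definition dlam_zero :: "complex fls \<Rightarrow> complex fls" where
  "dlam_zero f = fls_deriv f"
definition dlam_inf :: "complex fls \<Rightarrow> complex fls" where
  "dlam_inf f = - (fls_X ^ 2) * fls_deriv f"

definition res_zero :: "complex fls \<Rightarrow> complex" where
  "res_zero f = fls_nth f (- 1)"
definition res_inf :: "complex fls \<Rightarrow> complex" where
  "res_inf f = - fls_nth f 1"

section \<open>Formal solutions\<close>

text \<open>The series \<open>I + \<Sum>\<^bsub>k\<ge>1\<^esub> \<Phi>\<^sub>k z\<^sup>k\<close>; the value of \<^term>\<open>\<Phi> 0\<close> is irrelevant.\<close>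

definition matrix_series :: "(nat \<Rightarrow> complex ^ 2 ^ 2) \<Rightarrow> complex fls ^ 2 ^ 2" where
  "matrix_series \<Phi> =
     (\<chi> i j. fps_to_fls (Abs_fps (\<lambda>k. (if k = 0 then Finite_Cartesian_Product.mat 1 else \<Phi> k) $ i $ j)))"

text \<open>
  A formal expression \<open>Y(\<lambda>) exp(T(\<lambda>))\<close> with a diagonal exponent \<open>T\<close> (which may contain
  \<open>log \<lambda>\<close>) satisfies \<open>\<partial>\<Phi>/\<partial>\<lambda> = A \<Phi>\<close> iff \<open>Y' + Y T' = A Y\<close> as formal Laurent series,
  because \<open>exp(T)\<close> can be cancelled.  The argument \<open>L\<close> is \<open>T'\<close>.
\<close>

definition formal_solution ::
  "(complex fls \<Rightarrow> complex fls) \<Rightarrow> complex fls ^ 2 ^ 2 \<Rightarrow> complex fls ^ 2 ^ 2 \<Rightarrow> complex fls ^ 2 ^ 2 \<Rightarrow> bool"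
where
  "formal_solution dlam A Y L \<longleftrightarrow> map_matrix dlam Y + Y ** L = A ** Y"

text \<open>\<open>\<partial>/\<partial>\<lambda>\<close> of \<open>(- \<theta>\<^sub>\<infinity>/2 log \<lambda> - t\<lambda>/2) \<sigma>\<^sub>3\<close>\<close>

definition exponent_deriv_inf :: "real \<Rightarrow> nat \<Rightarrow> real \<Rightarrow> complex fls ^ 2 ^ 2" where
  "exponent_deriv_inf \<alpha> n t =
     sigma3_mult (fls_const (of_real (- theta_inf \<alpha> n / 2)) / lam_inf - fls_const (of_real t / 2))"

text \<open>\<open>\<partial>/\<partial>\<lambda>\<close> of \<open>(\<theta>\<^sub>0/2 log \<lambda> - t/(2\<lambda>)) \<sigma>\<^sub>3\<close>\<close>

definition exponent_deriv_zero :: "real \<Rightarrow> real \<Rightarrow> complex fls ^ 2 ^ 2" where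
  "exponent_deriv_zero \<alpha> t =
     sigma3_mult (fls_const (of_real (theta_zero \<alpha> / 2)) / lam_zero
                  + fls_const (of_real t / 2) / lam_zero ^ 2)"

definition formal_solution_inf ::
  "real \<Rightarrow> nat \<Rightarrow> real \<Rightarrow> (nat \<Rightarrow> complex ^ 2 ^ 2) \<Rightarrow> bool" where
  "formal_solution_inf \<alpha> n t \<Phi> \<longleftrightarrow>
     formal_solution dlam_inf (lax_matrix \<alpha> n t lam_inf) (matrix_series \<Phi>)
       (exponent_deriv_inf \<alpha> n t)"

definition formal_solution_zero ::
  "real \<Rightarrow> nat \<Rightarrow> real \<Rightarrow> complex ^ 2 ^ 2 \<Rightarrow> (nat \<Rightarrow> complex ^ 2 ^ 2) \<Rightarrow> bool" where
  "formal_solution_zero \<alpha> n t R \<Phi> \<longleftrightarrow>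
     Determinants.det R = 1 \<and>
     R ** sigma3_mult (of_real t / 2) ** matrix_inv R = A_minus2 \<alpha> n t \<and>
     formal_solution dlam_zero (lax_matrix \<alpha> n t lam_zero)
       (map_matrix fls_const R ** matrix_series \<Phi>) (exponent_deriv_zero \<alpha> t)"

section \<open>The Jimbo--Miwa--Ueno tau function\<close>

text \<open>The coefficient of \<open>dt\<close> in \<open>d ln \<tau>\<close>.\<close>

definition jmu_form_coeff ::
  "(nat \<Rightarrow> complex ^ 2 ^ 2) \<Rightarrow> (nat \<Rightarrow> complex ^ 2 ^ 2) \<Rightarrow> complex" where
  "jmu_form_coeff \<Phi>0 \<Phi>inf =
     (let Y0 = matrix_series \<Phi>0; Yinf = matrix_series \<Phi>inf;
          dT0 = sigma3_mult (- 1 / (2 * lam_zero)); dTinf = sigma3_mult (- lam_inf / 2)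
      in - res_zero (trace (matrix_inv Y0 ** map_matrix dlam_zero Y0 ** dT0))
         - res_inf (trace (matrix_inv Yinf ** map_matrix dlam_inf Yinf ** dTinf)))"

text \<open>
  The functions \<open>\<tau>\<close> on \<open>t > 0\<close> with \<open>d ln \<tau>\<close> as prescribed, i.e. all representatives of the
  \<open>\<tau>\<close>-function, which is only defined up to a multiplicative constant.
\<close>

definition is_tau_function :: "real \<Rightarrow> nat \<Rightarrow> (real \<Rightarrow> complex) \<Rightarrow> bool" where
  "is_tau_function \<alpha> n \<tau> \<longleftrightarrow>
     (\<forall>t>0. \<tau> t \<noteq> 0 \<and>
        (\<exists>\<Phi>inf R \<Phi>0. formal_solution_inf \<alpha> n t \<Phi>inf \<and> formal_solution_zero \<alpha> n t R \<Phi>0 \<and>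
           (\<tau> has_vector_derivative \<tau> t * jmu_form_coeff \<Phi>0 \<Phi>inf) (at t)))"

end

theory Submission
  imports Defs "HOL-Real_Asymp.Real_Asymp"
begin

hide_const (open) Module.module.smult
no_notation Matrix.vec_index (infixl "$" 100)
no_notation fps_nth (infixl "$" 75)

text \<open>
  The coefficient of \<open>d ln \<tau>\<close> involves only the diagonals of the first coefficients of the two
  formal solutions.  Both systems have the shape
  \<open>z\<^sup>2 Y' + Y (a z + b) \<sigma>\<^sub>3 = (M\<^sub>0 z\<^sup>2 + M\<^sub>1 z + b \<sigma>\<^sub>3) Y\<close>, at infinity directly and at zero after
  conjugation with \<open>R\<close>, and comparing coefficients up to \<open>z\<^sup>2\<close> gives, with
  \<open>y = p\<^sub>n q\<^sub>n\<close> and \<open>\<beta> = h\<^sub>n / h\<^bsub>n-1\<^esub>\<close>,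
  \<open>d ln \<tau> / dt = 2 t y - t + (n (n + \<alpha>) - 2 \<beta>) / t\<close>.
  The formal solution at zero exists because \<open>tr (A\<^bsub>-2\<^esub> A\<^bsub>-1\<^esub>) = \<alpha> t / 2\<close>, an identity for orthogonal
  polynomials obtained by expanding \<open>x P\<^sub>n'\<close> in terms of \<open>P\<^sub>n\<close>, \<open>P\<^bsub>n-1\<^esub>\<close> and the reproducing kernel
  at \<open>0\<close>.

  On the other side, \<open>s d ln D\<^sub>n / ds = - s \<Sum>\<^bsub>j<n\<^esub> (\<integral> P\<^sub>j\<^sup>2 w / x) / h\<^sub>j\<close>; integrating
  \<open>(x P\<^sub>j\<^sup>2 w)'\<close> and \<open>(x P\<^sub>n P\<^bsub>n-1\<^esub> w)'\<close> by parts turns this into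
  \<open>s y + n (n + \<alpha>) - \<beta>\<close>.  With \<open>s = t\<^sup>2\<close> the two logarithmic derivatives differ exactly by that of
  \<open>exp (t\<^sup>2 / 2) t powr (n (n + \<alpha>))\<close>.
\<close>

section \<open>Orthogonal polynomials of a positive functional\<close>

text \<open>
  \<open>N\<close> stands for \<open>f \<mapsto> \<integral> f w / x\<close> rather than \<open>f \<mapsto> \<integral> f w\<close>, so that the integrals with a factor \<open>1/x\<close>
  are values of \<open>N\<close> at polynomials; the inner product for the weight \<open>w\<close> is then \<open>N (x f g)\<close>.
\<close>

locale positive_functional =
  fixes N :: "real poly \<Rightarrow> real"
  assumes N_add: "N (f + g) = N f + N g"
    and N_smult: "N (smult c f) = c * N f"
    and N_pos: "\<lbrakk>\<And>x. x > 0 \<Longrightarrow> poly f x \<ge> 0; f \<noteq> 0\<rbrakk> \<Longrightarrow> N f > 0"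
begin

lemma N_0 [simp]: "N 0 = 0"
  using N_smult[of 0 0] by simp

lemma N_minus: "N (- f) = - N f"
  using N_smult[of "-1" f] by simp

lemma N_diff: "N (f - g) = N f - N g"
  using N_add[of f "- g"] N_minus[of g] by simp

definition ip :: "real poly \<Rightarrow> real poly \<Rightarrow> real" where
  "ip f g = N (pCons 0 (f * g))"

lemma ip_commute: "ip f g = ip g f"
  by (simp add: ip_def mult.commute)

lemma N_pCons_add: "N (pCons 0 (f + g)) = N (pCons 0 f) + N (pCons 0 g)"
  using N_add[of "pCons 0 f" "pCons 0 g"] by simp

lemma N_pCons_diff: "N (pCons 0 (f - g)) = N (pCons 0 f) - N (pCons 0 g)"
  using N_diff[of "pCons 0 f" "pCons 0 g"] by simp

lemma N_pCons_smult: "N (pCons 0 (smult c f)) = c * N (pCons 0 f)"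
  using N_smult[of c "pCons 0 f"] by simp

lemma ip_add_right: "ip f (g + k) = ip f g + ip f k"
  by (simp add: ip_def distrib_left N_pCons_add)

lemma ip_diff_right: "ip f (g - k) = ip f g - ip f k"
  by (simp add: ip_def right_diff_distrib N_pCons_diff)

lemma ip_smult_right: "ip f (smult c g) = c * ip f g"
  by (simp add: ip_def N_pCons_smult)

lemma ip_0_right [simp]: "ip f 0 = 0"
  by (simp add: ip_def)

lemma ip_sum_right: "ip f (\<Sum>i\<in>A. g i) = (\<Sum>i\<in>A. ip f (g i))"
  by (induction A rule: infinite_finite_induct) (auto simp: ip_add_right)

lemma ip_diff_left: "ip (f - g) k = ip f k - ip g k"
  using ip_diff_right[of k f g] by (simp add: ip_commute)

lemma ip_sum_left: "ip (\<Sum>i\<in>A. g i) f = (\<Sum>i\<in>A. ip (g i) f)"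
  using ip_sum_right[of f g A] by (simp add: ip_commute)

lemma ip_smult_left: "ip (smult c g) f = c * ip g f"
  using ip_smult_right[of f c g] by (simp add: ip_commute)

lemma ip_pCons: "ip f (pCons 0 g) = ip (pCons 0 f) g"
  by (simp add: ip_def)

lemma ip_self_pos: "f \<noteq> 0 \<Longrightarrow> ip f f > 0"
  unfolding ip_def by (rule N_pos) auto

definition monic_orthogonal :: "(nat \<Rightarrow> real poly) \<Rightarrow> bool" where
  "monic_orthogonal P \<longleftrightarrow>
     (\<forall>j. degree (P j) = j \<and> lead_coeff (P j) = 1) \<and> (\<forall>j k. j \<noteq> k \<longrightarrow> ip (P j) (P k) = 0)"

end

text \<open>Subtracting \<open>smult (coeff f n) (P n)\<close> lowers the degree bound by one, so a
  linear property has to be checked on the \<open>P j\<close> only. The bound is expressed by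
  vanishing coefficients, which for \<open>n = 0\<close> leaves just the zero polynomial.\<close>

lemma monic_expansion_induct:
  fixes P :: "nat \<Rightarrow> real poly"
  assumes "\<And>j. j < n \<Longrightarrow> degree (P j) = j \<and> lead_coeff (P j) = 1"
    and "\<And>i. i \<ge> n \<Longrightarrow> coeff f i = 0"
    and "Q 0" "\<And>f g. Q f \<Longrightarrow> Q g \<Longrightarrow> Q (f + g)" "\<And>c f. Q f \<Longrightarrow> Q (smult c f)"
    and "\<And>j. j < n \<Longrightarrow> Q (P j)"
  shows "Q f"
  using assms(1,2,6)
proof (induction n arbitrary: f)
  case 0
  then have "f = 0" by (simp add: poly_eq_iff)
  then show ?case using assms(3) by simp
next
  case (Suc n)
  define g where "g = f - smult (coeff f n) (P n)"
  have *: "degree (P n) = n" "coeff (P n) n = 1" using Suc.prems(1)[of n] by auto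
  have "coeff g i = 0" if "i \<ge> n" for i
  proof (cases "i = n")
    case True
    then show ?thesis using * by (simp add: g_def)
  next
    case False
    then show ?thesis using * that Suc.prems(2)[of i] coeff_eq_0[of "P n" i] by (simp add: g_def)
  qed
  then have "Q g" using Suc.IH Suc.prems by (metis less_SucI)
  moreover have "Q (smult (coeff f n) (P n))" using assms(5) Suc.prems(3) by blast
  ultimately have "Q (g + smult (coeff f n) (P n))" using assms(4) by blast
  then show ?case by (simp add: g_def)
qed

lemma coeff_x_pderiv: "coeff (pCons 0 (pderiv f)) i = real i * coeff f i" for f :: "real poly"
  by (cases i) (auto simp: coeff_pderiv)

locale orthogonal_polynomials = positive_functional N for N +
  fixes P :: "nat \<Rightarrow> real poly"
  assumes monic_orth: "monic_orthogonal P"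
begin

lemma degree_P [simp]: "degree (P j) = j" and lead_P [simp]: "coeff (P j) j = 1"
  and orth: "j \<noteq> k \<Longrightarrow> ip (P j) (P k) = 0"
  using monic_orth unfolding monic_orthogonal_def by metis+

lemma coeff_P_above: "i > j \<Longrightarrow> coeff (P j) i = 0"
  by (simp add: coeff_eq_0)

lemma P_nz [simp]: "P j \<noteq> 0"
  by (metis coeff_0 lead_P zero_neq_one)

lemma low_degree_induct:
  assumes "\<And>i. i \<ge> n \<Longrightarrow> coeff f i = 0"
    and "Q 0" "\<And>f g. Q f \<Longrightarrow> Q g \<Longrightarrow> Q (f + g)" "\<And>c f. Q f \<Longrightarrow> Q (smult c f)"
    and "\<And>j. j < n \<Longrightarrow> Q (P j)"
  shows "Q f"
  by (rule monic_expansion_induct[of n P f]) (use assms in auto)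

lemma orth_low: "(\<And>i. i \<ge> n \<Longrightarrow> coeff f i = 0) \<Longrightarrow> ip (P n) f = 0"
  by (rule low_degree_induct[of n f]) (auto simp: ip_add_right ip_smult_right orth)

definition h :: "nat \<Rightarrow> real" where "h n = ip (P n) (P n)"
text \<open>Because \<open>N\<close> integrates against w / x, this is the integral that occurs in
  \<open>p_fun\<close>.\<close>

definition I :: "nat \<Rightarrow> real" where "I n = N (P n)"

lemma h_pos: "h n > 0"
  unfolding h_def by (rule ip_self_pos) simp

text \<open>Removing \<open>smult (coeff f n) (P n)\<close> from \<open>f\<close> leaves a
  polynomial of degree below \<open>n\<close>, which is orthogonal to \<open>P n\<close>.\<close>

lemma ip_P_top:
  assumes "\<And>i. i > n \<Longrightarrow> coeff f i = 0"
  shows "ip (P n) f = coeff f n * h n"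
proof -
  have "ip (P n) (f - smult (coeff f n) (P n)) = 0"
  proof (rule orth_low)
    fix i assume "i \<ge> n"
    then show "coeff (f - smult (coeff f n) (P n)) i = 0"
      using assms[of i] coeff_P_above[of n i] by (cases "i = n") auto
  qed
  then show ?thesis by (simp add: ip_diff_right ip_smult_right h_def)
qed

text \<open>After splitting off the constant term of \<open>f\<close>, the rest
  \<open>pCons 0 g\<close> contributes \<open>ip (P n) g\<close>, which vanishes by degree. Degree
  \<open>n\<close> itself is allowed for \<open>f\<close>.\<close>

lemma N_P_mult: 
  assumes "\<And>i. i > n \<Longrightarrow> coeff f i = 0"
  shows "N (P n * f) = poly f 0 * I n"
proof (cases f)
  case (pCons c g)
  have "ip (P n) g = 0"
  proof (rule orth_low)
    fix i assume "i \<ge> n" then show "coeff g i = 0" using assms[of "Suc i"] pCons by simp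
  qed
  then show ?thesis by (simp add: pCons N_add N_smult ip_def I_def)
qed

lemma ip_P_Suc_pCons: "ip (P (Suc m)) (pCons 0 (P m)) = h (Suc m)"
  by (subst ip_P_top) (auto simp: coeff_pCons coeff_P_above split: nat.splits)

text \<open>Both sides evaluate \<open>N (P m * P (Suc m))\<close>: once by \<open>N_P_mult\<close>,
  once after splitting off the constant term of \<open>P (Suc m)\<close>, whose remaining factor is
  monic of degree \<open>m\<close>.\<close>

lemma N_P_P_Suc: "poly (P m) 0 * I (Suc m) = h m + poly (P (Suc m)) 0 * I m"
proof (cases "P (Suc m)")
  case (pCons c g)
  have g: "coeff g i = coeff (P (Suc m)) (Suc i)" for i by (simp add: pCons)
  have "ip (P m) g = coeff g m * h m"
    by (rule ip_P_top) (simp add: g coeff_P_above)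
  then have "ip (P m) g = h m" by (simp add: g)
  then have "N (P m * P (Suc m)) = h m + poly (P (Suc m)) 0 * I m"
    by (simp add: pCons N_add N_smult ip_def I_def)
  moreover have "N (P (Suc m) * P m) = poly (P m) 0 * I (Suc m)"
    by (rule N_P_mult) (simp add: coeff_P_above)
  ultimately show ?thesis by (simp add: mult.commute)
qed

text \<open>If \<open>P n\<close> were \<open>pCons 0 g\<close>, orthogonality to the lower degree
  polynomial \<open>g\<close> would make \<open>N\<close> vanish at the square of
  \<open>P n\<close>.\<close>

lemma P_at_0_nz: "poly (P n) 0 \<noteq> 0"
proof
  assume "poly (P n) 0 = 0"
  then obtain g where g: "P n = pCons 0 g" by (cases "P n") auto
  have "ip (P n) g = 0"
  proof (rule orth_low)
    fix i assume "i \<ge> n" 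
    then show "coeff g i = 0" using coeff_P_above[of n "Suc i"] g by simp
  qed
  moreover have "ip (P n) g > 0"
    unfolding ip_def g by (rule N_pos) (use g P_nz[of n] in \<open>auto simp: zero_le_mult_iff\<close>)
  ultimately show False by simp
qed

text \<open>The coefficient of \<open>x\<^bsup>n-1\<^esup>\<close> in \<open>P n\<close>, with value \<open>0\<close> for \<open>n = 0\<close>.\<close>

definition sublead :: "nat \<Rightarrow> real" where "sublead n = coeff (pCons 0 (P n)) n"

text \<open>The diagonal coefficient of the three-term recurrence, read off from the degree
  \<open>n\<close> part of x P_n - P_(n+1).\<close>

lemma ip_P_x_P: "ip (P n) (pCons 0 (P n)) = (sublead n - sublead (Suc n)) * h n"
proof -
  have "ip (P n) (pCons 0 (P n) - P (Suc n)) = coeff (pCons 0 (P n) - P (Suc n)) n * h n"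
  proof (rule ip_P_top)
    fix i assume "i > n"
    then show "coeff (pCons 0 (P n) - P (Suc n)) i = 0"
      by (cases "i = Suc n") (auto simp: coeff_pCons coeff_P_above split: nat.splits)
  qed
  then show ?thesis by (simp add: ip_diff_right orth sublead_def)
qed

lemma ip_x_pderiv:
  assumes "\<And>i. i > n \<Longrightarrow> coeff f i = 0"
  shows "ip (P n) (pCons 0 (pderiv f)) = real n * coeff f n * h n"
proof -
  show ?thesis by (subst ip_P_top) (use assms in \<open>auto simp: coeff_x_pderiv\<close>)
qed

text \<open>The difference of two candidates of degree \<open>n\<close> has lower degree, so it is
  orthogonal to both and therefore to itself.\<close>

lemma orthogonal_polynomials_unique:
  assumes "monic_orthogonal Q"
  shows "Q = P"
proof
  fix n
  interpret Q: orthogonal_polynomials N Q by unfold_locales fact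
  have low: "coeff (Q n - P n) i = 0" if "i \<ge> n" for i
    using that coeff_P_above[of n i] Q.coeff_P_above[of n i] by (cases "i = n") auto
  have "ip (Q n - P n) (Q n - P n) = 0"
    using orth_low[of n, OF low] Q.orth_low[of n, OF low] by (simp add: ip_diff_left)
  then show "Q n = P n" using ip_self_pos[of "Q n - P n"] by auto
qed

text \<open>The Christoffel-Darboux kernel K_n(x, 0); it represents evaluation at 0 on polynomials
  of degree below \<open>n\<close>.\<close>

definition kernel0 :: "nat \<Rightarrow> real poly" where
  "kernel0 n = (\<Sum>j<n. smult (poly (P j) 0 / h j) (P j))"

lemma coeff_kernel0: "i \<ge> n \<Longrightarrow> coeff (kernel0 n) i = 0"
  by (simp add: kernel0_def coeff_sum coeff_P_above)

lemma coeff_kernel0_top: "coeff (kernel0 (Suc m)) m = poly (P m) 0 / h m"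
  by (simp add: kernel0_def coeff_sum coeff_P_above)

lemma kernel0_reproducing:
  assumes "\<And>i. i \<ge> n \<Longrightarrow> coeff f i = 0"
  shows "ip (kernel0 n) f = poly f 0"
proof (rule low_degree_induct[of n f])
  fix k assume k: "k < n"
  have "ip (kernel0 n) (P k) = (\<Sum>j<n. if j = k then poly (P k) 0 else 0)"
    unfolding kernel0_def ip_sum_left ip_smult_left
    by (rule sum.cong) (use h_pos[of k] in \<open>auto simp: orth h_def\<close>)
  then show "ip (kernel0 n) (P k) = poly (P k) 0" using k by simp
qed (use assms in \<open>auto simp: ip_add_right ip_smult_right\<close>)

end

section \<open>Existence of the orthogonal polynomials\<close>

context positive_functional
begin

text \<open>Gram-Schmidt applied to \<open>monom 1 n\<close>. Orthogonality is claimed against all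
  polynomials of lower degree, not against earlier choices, so the degrees decouple and one sequence
  can be picked afterwards.\<close>

lemma ex_orthogonal_poly:
  "\<exists>p. degree p = n \<and> lead_coeff p = 1 \<and> (\<forall>f. (\<forall>i\<ge>n. coeff f i = 0) \<longrightarrow> ip p f = 0)"
proof (induction n rule: less_induct)
  case (less n)
  then obtain P where P: "\<And>j. j < n \<Longrightarrow> degree (P j) = j \<and> lead_coeff (P j) = 1"
    "\<And>j f. j < n \<Longrightarrow> (\<And>i. i \<ge> j \<Longrightarrow> coeff f i = 0) \<Longrightarrow> ip (P j) f = 0"
    by metis
  have orth: "ip (P j) (P k) = 0" if "j < n" "k < n" "j \<noteq> k" for j k
  proof (cases "k < j")
    case True
    then show ?thesis using P(1)[of k] that by (intro P(2)) (auto intro: coeff_eq_0)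
  next
    case False
    then show ?thesis using P(1)[of j] that
      by (subst ip_commute, intro P(2)) (auto intro: coeff_eq_0)
  qed
  have nz: "ip (P j) (P j) \<noteq> 0" if "j < n" for j
    using ip_self_pos[of "P j"] P(1)[OF that] by fastforce
  define p where "p = monom 1 n - (\<Sum>j<n. smult (ip (monom 1 n) (P j) / ip (P j) (P j)) (P j))"
  have cp: "coeff p i = (if i = n then 1 else 0)" if "i \<ge> n" for i
  proof -
    have "coeff (P j) i = 0" if "j < n" for j
      using that \<open>i \<ge> n\<close> P(1)[of j] by (auto intro: coeff_eq_0)
    then show ?thesis by (simp add: p_def coeff_sum)
  qed
  have "degree p \<le> n" by (rule degree_le) (simp add: cp)
  moreover have "coeff p n = 1" by (simp add: cp)
  ultimately have deg: "degree p = n" by (metis le_antisym le_degree zero_neq_one)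
  have "ip p f = 0" if "\<forall>i\<ge>n. coeff f i = 0" for f
  proof (rule monic_expansion_induct[of n P f "\<lambda>f. ip p f = 0"])
    fix k assume k: "k < n"
    have "ip p (P k) = ip (monom 1 n) (P k)
        - (\<Sum>j<n. ip (monom 1 n) (P j) / ip (P j) (P j) * ip (P j) (P k))"
      by (simp add: p_def ip_diff_left ip_sum_left ip_smult_left)
    also have "(\<Sum>j<n. ip (monom 1 n) (P j) / ip (P j) (P j) * ip (P j) (P k)) =
       (\<Sum>j<n. if j = k then ip (monom 1 n) (P k) else 0)"
      by (rule sum.cong) (use orth nz k in auto)
    finally show "ip p (P k) = 0" using k by simp
  next
    fix j assume "j < n"
    then show "degree (P j) = j \<and> lead_coeff (P j) = 1" by (rule P(1))
  qed (use that in \<open>auto simp: ip_add_right ip_smult_right\<close>)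
  then show ?case using deg \<open>coeff p n = 1\<close> by auto
qed

lemma ex_monic_orthogonal: "\<exists>P. monic_orthogonal P"
proof -
  obtain P where P: "\<And>n. degree (P n) = n \<and> lead_coeff (P n) = 1"
    "\<And>n f. (\<And>i. i \<ge> n \<Longrightarrow> coeff f i = 0) \<Longrightarrow> ip (P n) f = 0"
    using ex_orthogonal_poly by metis
  have "ip (P j) (P k) = 0" if "j \<noteq> k" for j k
  proof (cases "k < j")
    case True
    then show ?thesis using P(1)[of k] by (intro P(2)) (auto intro: coeff_eq_0)
  next
    case False
    then show ?thesis using P(1)[of j] that
      by (subst ip_commute, intro P(2)) (auto intro: coeff_eq_0)
  qed
  then show ?thesis using P(1) unfolding monic_orthogonal_def by blast
qed

end

section \<open>Identities obtained from integration by parts\<close>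

locale laguerre_polynomials = orthogonal_polynomials N P for N P +
  fixes \<alpha> s :: real
  assumes by_parts: \<comment> \<open>\<open>\<integral> (x f w)' = 0\<close> for \<open>w = x powr \<alpha> * exp (- x - s / x)\<close>\<close>
    "N (pCons 0 (smult (1 + \<alpha>) f + pCons 0 (pderiv f) - pCons 0 f)) + s * N f = 0"
begin

lemma by_parts_ip:
  "(1 + \<alpha>) * ip f g + ip (pCons 0 (pderiv f)) g + ip f (pCons 0 (pderiv g))
     - ip f (pCons 0 g) + s * N (f * g) = 0"
proof -
  have "N (pCons 0 (pCons 0 (f * pderiv g + g * pderiv f))) =
      N (pCons 0 (pCons 0 (f * pderiv g))) + N (pCons 0 (pCons 0 (g * pderiv f)))"
    using N_pCons_add[of "pCons 0 (f * pderiv g)" "pCons 0 (g * pderiv f)"] by simp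
  then show ?thesis
    using by_parts[of "f * g"]
    by (simp add: pderiv_mult N_pCons_add N_pCons_diff N_pCons_smult ip_def distrib_left mult.commute)
qed

text \<open>Integration by parts for the pair \<open>P (Suc m)\<close>, \<open>P m\<close>. Since x
  d/dx multiplies the coefficient of x^i by i, the polynomial x P_(m+1)' - (m+1) P_(m+1) has
  coefficient \<open>- sublead (Suc m)\<close> in degree \<open>m\<close> and none above.\<close>

lemma s_cross: "s * (poly (P m) 0 * I (Suc m)) = h (Suc m) + sublead (Suc m) * h m"
proof -
  have "ip (P m) (pCons 0 (pderiv (P (Suc m))) - smult (real (Suc m)) (P (Suc m))) = 
      - sublead (Suc m) * h m"
  proof (subst ip_P_top)
    show "coeff (pCons 0 (pderiv (P (Suc m))) - smult (real (Suc m)) (P (Suc m))) m * h m =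
      - sublead (Suc m) * h m" by (simp add: coeff_x_pderiv sublead_def del: coeff_pCons_Suc) (simp add: algebra_simps)
    fix i assume "m < i"
    then show "coeff (pCons 0 (pderiv (P (Suc m))) - smult (real (Suc m)) (P (Suc m))) i = 0"
      by (cases "i = Suc m") (auto simp: coeff_x_pderiv coeff_P_above simp del: coeff_pCons_Suc)
  qed
  then have "ip (pCons 0 (pderiv (P (Suc m)))) (P m) = - sublead (Suc m) * h m"
    by (simp add: ip_diff_right ip_smult_right orth ip_commute)
  moreover have "ip (P (Suc m)) (pCons 0 (pderiv (P m))) = 0"
    by (subst ip_x_pderiv) (auto simp: coeff_P_above)
  moreover have "N (P (Suc m) * P m) = poly (P m) 0 * I (Suc m)"
    by (rule N_P_mult) (simp add: coeff_P_above)
  ultimately show ?thesis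
    using by_parts_ip[of "P (Suc m)" "P m"] ip_P_Suc_pCons[of m] by (simp add: orth)
qed

text \<open>The diagonal case of \<open>by_parts_ip\<close>; the term with an extra factor x brings
  in the recurrence coefficient from \<open>ip_P_x_P\<close>.\<close>

lemma s_square: "s * N (P j * P j) = (sublead j - sublead (Suc j) - (1 + \<alpha> + 2 * real j)) * h j"
proof -
  have "ip (P j) (pCons 0 (pderiv (P j))) = real j * h j"
    by (subst ip_x_pderiv) (auto simp: coeff_P_above)
  then show ?thesis
    using by_parts_ip[of "P j" "P j"] ip_P_x_P[of j]
    by (simp add: ip_commute[of "pCons 0 (pderiv (P j))"] h_def algebra_simps)
qed

text \<open>The differences of \<open>sublead\<close> telescope from \<open>sublead 0 = 0\<close>,
  and the numbers 1 + \<alpha> + 2 j for j < n add up to n (n + \<alpha>).\<close>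

lemma s_sum_squares:
  "s * (\<Sum>j<n. N (P j * P j) / h j) = - sublead n - real n * (real n + \<alpha>)"
proof (induction n)
  case 0
  show ?case by (simp add: sublead_def)
next
  case (Suc n)
  have "s * (N (P n * P n) / h n) = sublead n - sublead (Suc n) - (1 + \<alpha> + 2 * real n)"
    using s_square[of n] h_pos[of n] by (simp add: field_simps)
  then show ?case using Suc by (simp add: distrib_left algebra_simps)
qed

text \<open>By \<open>hankel_det_derivative\<close> the left side is s times the logarithmic
  s-derivative of the Hankel determinant. \<open>s_cross\<close> replaces the
  \<open>sublead n\<close> left over from \<open>s_sum_squares\<close>.\<close>

lemma log_derivative_identity:
  assumes "n = Suc m"
  shows "- s * (\<Sum>j<n. N (P j * P j) / h j) =
     s * (poly (P m) 0 * I n / h m) + real n * (real n + \<alpha>) - h n / h m"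
proof -
  have "s * (poly (P m) 0 * I n / h m) = h n / h m + sublead n"
    using s_cross[of m] h_pos[of m] assms by (simp add: field_simps)
  then show ?thesis using s_sum_squares[of n] by simp
qed

text \<open>The difference of the two sides has degree below \<open>n\<close> and is orthogonal to
  all polynomials \<open>f\<close> of such degree, hence to itself. The term
  \<open>s * N (P n * f)\<close> of the integration by parts is a multiple of f(0), which accounts
  for the kernel.\<close>

lemma x_pderiv_P:
  assumes n: "n = Suc m"
  shows "pCons 0 (pderiv (P n)) =
     smult (real n) (P n) + smult (h n / h m) (P m) - smult (s * I n) (kernel0 n)" (is "?L = ?R")
proof -
  define d where "d = ?L - ?R"
  have low: "coeff d i = 0" if "i \<ge> n" for i
    using that n
    by (cases "i = n") (auto simp: d_def coeff_x_pderiv coeff_P_above coeff_kernel0 simp del: coeff_pCons_Suc)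
  have "ip d f = 0" if f: "\<And>i. i \<ge> n \<Longrightarrow> coeff f i = 0" for f
  proof -
    have 1: "ip (P n) f = 0" using f by (rule orth_low)
    have 2: "ip (P n) (pCons 0 (pderiv f)) = 0"
      by (subst ip_x_pderiv) (use f in auto)
    have 3: "N (P n * f) = poly f 0 * I n"
      by (rule N_P_mult) (use f in auto)
    have 4: "ip (P n) (pCons 0 f) = coeff f m * h n"
      by (subst ip_P_top) (use f n in \<open>auto simp: coeff_pCons split: nat.splits\<close>)
    have 5: "ip (P m) f = coeff f m * h m"
      by (rule ip_P_top) (use f n in auto)
    have "ip ?L f = coeff f m * h n - s * (poly f 0 * I n)"
      using by_parts_ip[of "P n" f] by (simp add: 1 2 3 4)
    moreover have "ip ?R f = h n / h m * ip (P m) f - s * I n * poly f 0"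
      using kernel0_reproducing[of n f] f 1
      by (simp add: ip_commute[of _ f] ip_add_right ip_diff_right ip_smult_right)
    ultimately show ?thesis using h_pos[of m] by (simp add: d_def ip_diff_left 5)
  qed
  then have "ip d d = 0" using low by blast
  then have "d = 0" using ip_self_pos[of d] by force
  then show ?thesis by (simp add: d_def)
qed

text \<open>Integration by parts for \<open>P m\<close> and \<open>kernel0 n\<close>, all pairings
  being known from the reproducing property or the leading coefficient of the kernel. It serves to
  eliminate K_n(0, 0) from \<open>residue_identity\<close>.\<close>

lemma kernel_at_0:
  assumes n: "n = Suc m"
  shows "(real n + \<alpha>) * poly (P m) 0 + poly (P n) 0 + s * poly (kernel0 n) 0 * I m = 0"
proof -
  let ?K = "kernel0 n"
  have K: "coeff ?K i = 0" if "i > m" for i using that n by (auto intro: coeff_kernel0)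
  have 1: "ip ?K (pCons 0 (pderiv (P m))) = 0"
    using kernel0_reproducing[of n "pCons 0 (pderiv (P m))"] n
    by (simp add: coeff_x_pderiv coeff_P_above del: coeff_pCons_Suc)
  have 2: "ip (P m) (pCons 0 (pderiv ?K)) = real m * poly (P m) 0"
    using ip_x_pderiv[of m ?K] K h_pos[of m] n coeff_kernel0_top[of m] by simp
  have 3: "ip (P m) ?K = poly (P m) 0"
    using ip_P_top[of m ?K] K h_pos[of m] n coeff_kernel0_top[of m] by simp
  \<comment> \<open>\<open>pCons 0 (P m)\<close> has degree \<open>n\<close>, too high for the
    reproducing property; subtracting \<open>P n\<close>, which is orthogonal to the kernel, lowers
    it.\<close>
  have "ip ?K (pCons 0 (P m) - P n) = poly (pCons 0 (P m) - P n) 0"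
  proof (rule kernel0_reproducing)
    fix i assume "i \<ge> n" then show "coeff (pCons 0 (P m) - P n) i = 0"
      using n by (cases "i = n") (auto simp: coeff_pCons coeff_P_above split: nat.splits)
  qed
  moreover have "ip (P n) ?K = 0" by (rule orth_low) (rule coeff_kernel0)
  ultimately have "ip ?K (pCons 0 (P m)) = - poly (P n) 0"
    by (simp add: ip_diff_right ip_commute[of ?K "P n"])
  then have 4: "ip (P m) (pCons 0 ?K) = - poly (P n) 0"
    by (simp only: ip_pCons ip_commute[of "pCons 0 (P m)"])
  have 5: "N (P m * ?K) = poly ?K 0 * I m" by (rule N_P_mult) (rule K)
  have "ip (pCons 0 (pderiv (P m))) ?K = 0" using 1 by (simp add: ip_commute)
  then show ?thesis
    using by_parts_ip[of "P m" ?K] unfolding 2 3 4 5 using n by (simp add: algebra_simps)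
qed

text \<open>The inner product of \<open>P m\<close> with P_n' is evaluated by its leading
  coefficient and by \<open>x_pderiv_P\<close>; \<open>kernel_at_0\<close> then removes the kernel
  together with the factor \<open>s\<close>. This is the source of the trace condition for the
  formal solution at zero.\<close>

lemma residue_identity:
  assumes n: "n = Suc m"
  shows "real n * h m =
    poly (P n) 0 * I n + h n / h m * (poly (P m) 0 * I m) + (2 * real n + \<alpha>) * (poly (P m) 0 * I n)"
proof -
  let ?K = "kernel0 n"
  have "ip (P m) (pderiv (P n)) = coeff (pderiv (P n)) m * h m"
    by (rule ip_P_top) (use n in \<open>auto simp: coeff_pderiv coeff_P_above\<close>)
  then have "real n * h m = N (P m * pCons 0 (pderiv (P n)))"
    using n by (simp add: coeff_pderiv ip_def)
  also have "\<dots> = real n * N (P n * P m) + h n / h m * N (P m * P m) - s * I n * N (P m * ?K)"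
    unfolding x_pderiv_P[OF n]
    by (simp add: distrib_left right_diff_distrib N_add N_diff N_smult mult.commute)
  also have "N (P n * P m) = poly (P m) 0 * I n"
    by (rule N_P_mult) (use n in \<open>auto simp: coeff_P_above\<close>)
  also have "N (P m * P m) = poly (P m) 0 * I m"
    by (rule N_P_mult) (auto simp: coeff_P_above)
  also have "N (P m * ?K) = poly ?K 0 * I m" 
    by (rule N_P_mult) (use n in \<open>auto intro: coeff_kernel0\<close>)
  also have "s * I n * (poly ?K 0 * I m) = - I n * ((real n + \<alpha>) * poly (P m) 0 + poly (P n) 0)"
  proof -
    have "s * poly ?K 0 * I m = - ((real n + \<alpha>) * poly (P m) 0 + poly (P n) 0)"
      using kernel_at_0[OF n] by linarith
    then have "I n * (s * poly ?K 0 * I m) = I n * - ((real n + \<alpha>) * poly (P m) 0 + poly (P n) 0)"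
      by simp
    then show ?thesis by (simp only: mult_ac mult_minus_right mult_minus_left)
  qed
  finally show ?thesis by (simp add: algebra_simps)
qed

end

section \<open>The moments\<close>

definition moment :: "real \<Rightarrow> real \<Rightarrow> real" where
  "moment a s = (LBINT x:{0<..}. x powr a * exp (- x - s / x))"

lemma set_integrable_powr_exp:
  assumes "a > -1"
  shows "set_integrable lborel {0<..} (\<lambda>x::real. x powr a * exp (- x))"
proof -
  have "((\<lambda>t. t powr a / exp t) has_integral Gamma (a + 1)) {0..}"
    using Gamma_integral_real[of "a + 1"] assms by simp
  then have "(\<lambda>t. t powr a / exp t) absolutely_integrable_on {0..}"
    by (intro nonnegative_absolutely_integrable_1) (auto simp: integrable_on_def)
  then have "set_integrable lebesgue {0<..} (\<lambda>t. t powr a / exp t)"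
    by (rule set_integrable_subset) auto
  then have "set_integrable lborel {0<..} (\<lambda>t. t powr a / exp t)"
    unfolding set_integrable_def by (subst (asm) integrable_completion) auto
  then show ?thesis
    by (simp add: exp_minus field_simps)
qed

lemma set_integrable_moment:
  assumes "a > -1" "s \<ge> 0"
  shows "set_integrable lborel {0<..} (\<lambda>x::real. x powr a * exp (- x - s / x))"
proof (rule set_integrable_bound[OF set_integrable_powr_exp[OF assms(1)]])
  show "set_borel_measurable lborel {0<..} (\<lambda>x. x powr a * exp (- x - s / x))"
    unfolding set_borel_measurable_def by measurable
qed (use assms(2) in auto)

text \<open>Supplies the integrable majorant of the difference quotients in
  \<open>moment_has_derivative\<close>.\<close>

lemma abs_exp_minus_diff_le:
  fixes u v :: real
  assumes "u \<ge> 0" "v \<ge> 0"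
  shows "\<bar>exp (- u) - exp (- v)\<bar> \<le> \<bar>u - v\<bar>"
proof -
  have *: "\<bar>exp (- u) - exp (- v)\<bar> \<le> \<bar>u - v\<bar>" if "0 \<le> u" "u \<le> v" for u v :: real
  proof -
    have "exp (- v) = exp (- u) * exp (u - v)" by (simp flip: exp_add)
    then have "exp (- u) - exp (- v) = exp (- u) * (1 - exp (u - v))" by (simp add: algebra_simps)
    also have "\<dots> \<le> 1 * (v - u)"
    proof (rule mult_mono)
      show "1 - exp (u - v) \<le> v - u" using exp_ge_add_one_self[of "u - v"] by linarith
    qed (use that in auto)
    finally show ?thesis using that by simp
  qed
  show ?thesis using *[of u v] *[of v u] assms by (cases "u \<le> v") auto
qed

text \<open>Differentiation under the integral by dominated convergence along sequences: the
  quotients are bounded by x powr (a - 1) exp (- x), integrable since \<open>a > 0\<close>.\<close>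

lemma moment_has_derivative:
  assumes "a > 0" "s > 0"
  shows "(moment a has_real_derivative - moment (a - 1) s) (at s)"
proof -
  let ?f = "\<lambda>s x. x powr a * exp (- x - s / x)"
  let ?q = "\<lambda>h x. (?f (s + h) x - ?f s x) / h"
  \<comment> \<open>Increments above \<open>- s\<close> keep \<open>s + h\<close> positive; as this
    set is open around 0, the limit is unaffected.\<close>
  let ?S = "{- s<..}"
  have "((\<lambda>h. (moment a (s + h) - moment a s) / h) \<longlongrightarrow> - moment (a - 1) s) (at 0 within ?S)"
    unfolding tendsto_at_iff_sequentially
  proof safe
    fix H :: "nat \<Rightarrow> real"
    assume H: "\<forall>i. H i \<in> ?S - {0}" "H \<longlonglongrightarrow> 0"
    have Hi: "H i > - s" "H i \<noteq> 0" for i using H(1)[rule_format, of i] by auto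
    have eq: "((\<lambda>h. (moment a (s + h) - moment a s) / h) \<circ> H) =
       (\<lambda>i. LINT x|lborel. indicator {0<..} x *\<^sub>R ?q (H i) x)"
    proof
      fix i
      have "(moment a (s + H i) - moment a s) / H i =
          (LBINT x:{0<..}. ?f (s + H i) x - ?f s x) / H i"
        unfolding moment_def using assms Hi[of i]
        by (subst set_integral_diff) (auto intro!: set_integrable_moment)
      also have "\<dots> = (LBINT x:{0<..}. ?q (H i) x)" by simp
      finally show "((\<lambda>h. (moment a (s + h) - moment a s) / h) \<circ> H) i =
         (LINT x|lborel. indicator {0<..} x *\<^sub>R ?q (H i) x)"
        by (simp add: set_lebesgue_integral_def)
    qed
    have "(\<lambda>i. LINT x|lborel. indicator {0<..} x *\<^sub>R ?q (H i) x) \<longlonglongrightarrow>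
        (LINT x|lborel. indicator {0<..} x *\<^sub>R - ?f s x / x)"
    proof (rule integral_dominated_convergence)
      show "integrable lborel (\<lambda>x. indicator {0<..} x *\<^sub>R (x powr (a - 1) * exp (- x)))"
        using set_integrable_powr_exp[of "a - 1"] assms by (simp add: set_integrable_def)
      have "(\<lambda>i. indicator {0<..} x *\<^sub>R ?q (H i) x) \<longlonglongrightarrow> indicator {0<..} x *\<^sub>R - ?f s x / x" for x
      proof (cases "x > 0")
        case True
        have "((\<lambda>s. ?f s x) has_real_derivative (- ?f s x / x)) (at s)"
          using True by (auto intro!: derivative_eq_intros)
        then have "((\<lambda>h. ?q h x) \<longlongrightarrow> - ?f s x / x) (at 0)"
          by (simp add: DERIV_def)
        then have "(\<lambda>i. ?q (H i) x) \<longlonglongrightarrow> - ?f s x / x"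
          by (rule filterlim_compose) (use H Hi in \<open>auto simp: filterlim_at\<close>)
        then show ?thesis using True by simp
      qed simp
      then show "AE x in lborel. (\<lambda>i. indicator {0<..} x *\<^sub>R ?q (H i) x) \<longlonglongrightarrow> 
          indicator {0<..} x *\<^sub>R - ?f s x / x" by simp
      fix i
      have "norm (?q (H i) x) \<le> x powr (a - 1) * exp (- x)" if "x > 0" for x
      proof -
        have "\<bar>?f (s + H i) x - ?f s x\<bar> = x powr a * exp (- x) * \<bar>exp (- ((s + H i) / x)) - exp (- (s / x))\<bar>"
        proof -
          have "?f (s + H i) x - ?f s x = x powr a * exp (- x) * (exp (- ((s + H i) / x)) - exp (- (s / x)))"
            unfolding diff_conv_add_uminus[of "- x"] exp_add by (simp only: right_diff_distrib mult.assoc)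
          then show ?thesis by (simp only: abs_mult abs_exp_cancel) simp
        qed
        also have "\<dots> \<le> x powr a * exp (- x) * \<bar>(s + H i) / x - s / x\<bar>"
          using that assms Hi[of i]
          by (intro mult_left_mono abs_exp_minus_diff_le divide_nonneg_pos) auto
        also have "(s + H i) / x - s / x = H i / x" by (simp add: add_divide_distrib)
        also have "x powr a * exp (- x) * \<bar>H i / x\<bar> = x powr (a - 1) * exp (- x) * \<bar>H i\<bar>"
          using that by (simp add: powr_diff)
        finally show ?thesis using Hi[of i] by (simp add: divide_le_eq)
      qed
      then show "AE x in lborel. norm (indicator {0<..} x *\<^sub>R ?q (H i) x) \<le>
          indicator {0<..} x *\<^sub>R (x powr (a - 1) * exp (- x))"
        by (auto simp: indicator_def)
    qed measurable
    also have "(LINT x|lborel. indicator {0<..} x *\<^sub>R - ?f s x / x) = 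
        (LINT x|lborel. - (indicator {0<..} x *\<^sub>R (x powr (a - 1) * exp (- x - s / x))))"
      by (rule Bochner_Integration.integral_cong) (auto simp: indicator_def powr_diff)
    also have "\<dots> = - moment (a - 1) s"
      by (simp add: moment_def set_lebesgue_integral_def)
    finally show "((\<lambda>h. (moment a (s + h) - moment a s) / h) \<circ> H) \<longlonglongrightarrow> - moment (a - 1) s"
      unfolding eq .
  qed
  moreover have "at 0 within ?S = at 0"
    by (rule at_within_open) (use assms in auto)
  ultimately show ?thesis by (simp add: DERIV_def)
qed

text \<open>The derivative of \<open>?F\<close> is \<open>?f\<close>, and \<open>?F\<close> tends to
  0 at both ends of the half-line. These are the monomial cases of \<open>by_parts\<close>.\<close>

lemma moment_by_parts:
  assumes "a > 0" "s > 0"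
  shows "(a + 1) * moment a s - moment (a + 1) s + s * moment (a - 1) s = 0"
proof -
  let ?F = "\<lambda>x::real. x powr (a + 1) * exp (- x - s / x)"
  let ?w = "\<lambda>b x. x powr b * exp (- x - s / x)"
  let ?f = "\<lambda>x. (a + 1) * ?w a x - ?w (a + 1) x + s * ?w (a - 1) x"
  have int: "set_integrable lborel {0<..} (?w b)" if "b \<ge> a - 1" for b
    using that assms by (intro set_integrable_moment) auto
  have lim0: "(?F \<longlongrightarrow> 0) (at_right 0)"
  proof (rule Lim_null_comparison)
    show "\<forall>\<^sub>F x in at_right 0. norm (?F x) \<le> x powr (a + 1)"
      using eventually_at_right_less[of "0::real"]
    proof eventually_elim
      case (elim x)
      then have "s / x \<ge> 0" using assms by simp
      then have "exp (- x - s / x) \<le> 1" using elim by simp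
      then show ?case by (simp add: mult_left_le)
    qed
    show "((\<lambda>x. x powr (a + 1)) \<longlongrightarrow> 0) (at_right (0::real))"
      using assms by real_asymp
  qed
  have liminf: "(?F \<longlongrightarrow> 0) at_top"
  proof (rule Lim_null_comparison)
    show "\<forall>\<^sub>F x in at_top. norm (?F x) \<le> x powr (a + 1) * exp (- x)"
      using eventually_gt_at_top[of "0::real"]
      by eventually_elim (use assms in auto)
    show "((\<lambda>x. x powr (a + 1) * exp (- x)) \<longlongrightarrow> 0) at_top"
      by real_asymp
  qed
  have "(LBINT x=0..\<infinity>. ?f x) = 0 - 0"
  proof (rule interval_integral_FTC_integrable)
    fix x :: real assume "(0::ereal) < ereal x"
    then have x: "x > 0" by simp
    have "((\<lambda>x. x powr (a + 1)) has_real_derivative (a + 1) * x powr a) (at x)"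
      using has_real_derivative_powr[OF x, of "a + 1"] by simp
    moreover have "((\<lambda>x. exp (- x - s / x)) has_real_derivative exp (- x - s / x) * (s / x\<^sup>2 - 1)) (at x)"
      using x by (auto intro!: derivative_eq_intros simp: power2_eq_square field_simps)
    ultimately have "(?F has_real_derivative
        (a + 1) * x powr a * exp (- x - s / x) + exp (- x - s / x) * (s / x\<^sup>2 - 1) * x powr (a + 1)) (at x)"
      by (rule DERIV_mult)
    also have "(a + 1) * x powr a * exp (- x - s / x) + exp (- x - s / x) * (s / x\<^sup>2 - 1) * x powr (a + 1) = ?f x"
      using x by (simp add: powr_diff powr_add field_simps power2_eq_square)
    finally show "(?F has_vector_derivative ?f x) (at x)"
      unfolding has_real_derivative_iff_has_vector_derivative .
    show "isCont ?f x" using x by (auto intro!: continuous_intros)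
  next
    have "set_integrable lborel {0<..} ?f"
      by (intro set_integral_add set_integral_diff set_integrable_mult_right int) auto
    then show "set_integrable lborel (einterval 0 \<infinity>) ?f"
      by (simp add: zero_ereal_def)
    show "((?F \<circ> real_of_ereal) \<longlongrightarrow> 0) (at_right 0)"
      unfolding zero_ereal_def by (subst ereal_tendsto_simps) (use lim0 in simp)
    show "((?F \<circ> real_of_ereal) \<longlongrightarrow> 0) (at_left \<infinity>)"
      by (subst ereal_tendsto_simps) (use liminf in simp)
  qed simp
  then have "(LBINT x:{0<..}. ?f x) = 0"
    unfolding zero_ereal_def interval_integral_to_infinity_eq by simp
  moreover have "(LBINT x:{0<..}. ?f x) = (a + 1) * moment a s - moment (a + 1) s + s * moment (a - 1) s"
    unfolding moment_def
    by (simp add: set_integral_add set_integral_diff set_integrable_mult_right int)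
  ultimately show ?thesis by simp
qed

section \<open>The functional of the weight and the Hankel determinant\<close>

definition laurent_functional :: "real \<Rightarrow> real \<Rightarrow> real poly \<Rightarrow> real" where
  "laurent_functional \<alpha> s f = weighted_integral \<alpha> s (\<lambda>x. poly f x / x)"

lemma weighted_poly_over_x:
  assumes "x > 0"
  shows "poly f x / x * weight \<alpha> s x =
    (\<Sum>i\<le>degree f. coeff f i * (x powr (\<alpha> + real i - 1) * exp (- x - s / x)))"
  unfolding poly_altdef weight_def sum_divide_distrib sum_distrib_right
  by (rule sum.cong) (use assms in \<open>auto simp: powr_diff powr_add powr_realpow\<close>)

lemma set_integrable_laurent:
  assumes "\<alpha> > 0" "s \<ge> 0"
  shows "set_integrable lborel {0<..} (\<lambda>x. poly f x / x * weight \<alpha> s x)"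
proof -
  have "set_integrable lborel {0<..} (\<lambda>x.
      \<Sum>i\<le>degree f. coeff f i * (x powr (\<alpha> + real i - 1) * exp (- x - s / x)))"
    unfolding set_integrable_def scaleR_sum_right
    by (rule Bochner_Integration.integrable_sum, fold set_integrable_def,
        rule set_integrable_mult_right, rule set_integrable_moment) (use assms in auto)
  also have "?this \<longleftrightarrow> ?thesis"
    by (rule set_integrable_cong) (simp_all only: weighted_poly_over_x greaterThan_iff)
  finally show ?thesis .
qed

lemma laurent_functional_add:
  assumes "\<alpha> > 0" "s \<ge> 0"
  shows "laurent_functional \<alpha> s (f + g) = laurent_functional \<alpha> s f + laurent_functional \<alpha> s g"
  using set_integral_add(2)[OF set_integrable_laurent[OF assms, of f] set_integrable_laurent[OF assms, of g]]
  by (simp add: laurent_functional_def weighted_integral_def add_divide_distrib distrib_right)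

lemma laurent_functional_smult:
  "laurent_functional \<alpha> s (Polynomial.smult c f) = c * laurent_functional \<alpha> s f"
  using set_integral_mult_right[of lborel "{0<..}" c "\<lambda>x. poly f x / x * weight \<alpha> s x"]
  by (simp add: laurent_functional_def weighted_integral_def mult.assoc)

lemma laurent_functional_pCons_0:
  "laurent_functional \<alpha> s (pCons 0 f) = weighted_integral \<alpha> s (poly f)"
  unfolding laurent_functional_def weighted_integral_def
  by (rule set_lebesgue_integral_cong) auto

text \<open>If the integral vanished, the nonnegative integrand would be zero almost everywhere, and
  the interval from 0 to 1 would lie in the finite root set of \<open>f\<close> up to a null
  set.\<close>

lemma laurent_functional_pos:
  assumes "\<alpha> > 0" "s \<ge> 0" and nonneg: "\<And>x. x > 0 \<Longrightarrow> poly f x \<ge> 0" and "f \<noteq> 0"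
  shows "laurent_functional \<alpha> s f > 0"
proof -
  let ?g = "\<lambda>x. indicator {0<..} x *\<^sub>R (poly f x / x * weight \<alpha> s x)"
  have int: "integrable lborel ?g"
    using set_integrable_laurent[OF assms(1,2)] by (simp add: set_integrable_def)
  have pos: "?g x \<ge> 0" for x using nonneg by (auto simp: indicator_def weight_def)
  have eq: "laurent_functional \<alpha> s f = integral\<^sup>L lborel ?g"
    by (simp add: laurent_functional_def weighted_integral_def set_lebesgue_integral_def)
  have "integral\<^sup>L lborel ?g \<noteq> 0"
  proof
    assume "integral\<^sup>L lborel ?g = 0"
    then have "AE x in lborel. ?g x = 0"
      using integral_nonneg_eq_0_iff_AE[OF int] pos by simp
    moreover have "AE x in lborel. x \<notin> {x. poly f x = 0}"
      using poly_roots_finite[OF \<open>f \<noteq> 0\<close>]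
      by (intro AE_not_in finite_imp_null_set_lborel)
    ultimately have "AE x in lborel. x \<notin> {0<..<1::real}"
      by eventually_elim (auto simp: weight_def)
    then show False
      by (subst (asm) AE_iff_measurable[of "{0<..<1}"]) auto
  qed
  moreover have "integral\<^sup>L lborel ?g \<ge> 0" using pos by simp
  ultimately show ?thesis using eq by simp
qed

lemma positive_functional_laurent:
  assumes "\<alpha> > 0" "s \<ge> 0"
  shows "positive_functional (laurent_functional \<alpha> s)"
  by unfold_locales
    (use assms in \<open>auto intro: laurent_functional_add laurent_functional_smult laurent_functional_pos\<close>)

lemma laurent_functional_monom:
  "laurent_functional \<alpha> s (monom 1 k) = moment (\<alpha> + real k - 1) s"
  unfolding laurent_functional_def weighted_integral_def moment_def
  by (rule set_lebesgue_integral_cong)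
     (auto simp: poly_monom weight_def powr_diff powr_add powr_realpow)

text \<open>By linearity it suffices to treat \<open>monom 1 j\<close>, which is
  \<open>moment_by_parts\<close> with exponent \<alpha> + j.\<close>

lemma laurent_functional_by_parts:
  assumes "\<alpha> > 0" "s > 0"
  shows "laurent_functional \<alpha> s (pCons 0 (Polynomial.smult (1 + \<alpha>) f + pCons 0 (pderiv f) - pCons 0 f))
     + s * laurent_functional \<alpha> s f = 0" (is "?Q f")
proof -
  interpret positive_functional "laurent_functional \<alpha> s"
    using assms by (intro positive_functional_laurent) auto
  show ?thesis
  proof (rule monic_expansion_induct[of "Suc (degree f)" "monom 1" f ?Q])
    fix j
    show "?Q (monom 1 j)"
    proof -
      have 1: "pCons 0 (monom (1::real) i) = monom 1 (Suc i)" for i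
        by (simp add: monom_Suc)
      have 3: "pCons 0 (pderiv (monom (1::real) j)) = Polynomial.smult (real j) (monom 1 j)"
        by (cases j) (simp_all add: pderiv_monom smult_monom flip: monom_Suc)
      show ?thesis
        using moment_by_parts[of "\<alpha> + real j" s] assms
        by (simp add: N_pCons_add N_pCons_diff N_pCons_smult N_smult 1 3 laurent_functional_monom algebra_simps)
    qed
  next
    show "?Q (f + g)" if "?Q f" "?Q g" for f g
    proof -
      have "Polynomial.smult (1 + \<alpha>) (f + g) + pCons 0 (pderiv (f + g)) - pCons 0 (f + g) =
         (Polynomial.smult (1 + \<alpha>) f + pCons 0 (pderiv f) - pCons 0 f) +
         (Polynomial.smult (1 + \<alpha>) g + pCons 0 (pderiv g) - pCons 0 g)"
        by (rule poly_eqI) (simp add: pderiv_add algebra_simps coeff_pCons split: nat.splits)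
      then show ?thesis
        using that unfolding N_pCons_add N_add distrib_left by (simp only: N_pCons_add)
    qed
    show "?Q (Polynomial.smult c f)" if "?Q f" for c f
    proof -
      have "Polynomial.smult (1 + \<alpha>) (Polynomial.smult c f) + pCons 0 (pderiv (Polynomial.smult c f)) - pCons 0 (Polynomial.smult c f) =
         Polynomial.smult c (Polynomial.smult (1 + \<alpha>) f + pCons 0 (pderiv f) - pCons 0 f)"
        by (simp add: pderiv_smult smult_add_right smult_diff_right mult.commute)
      then show ?thesis using that by (simp add: N_pCons_smult N_smult mult.left_commute flip: distrib_left)
    qed
  qed (auto simp: degree_monom_eq coeff_eq_0)
qed

text \<open>The s-derivative of the weight is - w / x, so an integral against w, written with
  \<open>pCons 0 f\<close>, turns into one against w / x. Linearity reduces this to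
  \<open>moment_has_derivative\<close>.\<close>

lemma laurent_functional_derivative:
  assumes "\<alpha> > 0" "s > 0"
  shows "((\<lambda>s. laurent_functional \<alpha> s (pCons 0 f)) has_real_derivative - laurent_functional \<alpha> s f) (at s)"
    (is "?Q f")
proof (rule monic_expansion_induct[of "Suc (degree f)" "monom 1" f ?Q])
  fix j
  have "pCons 0 (monom (1::real) j) = monom 1 (Suc j)" by (simp add: monom_Suc)
  then show "?Q (monom 1 j)"
    using moment_has_derivative[of "\<alpha> + real j" s] assms
    by (simp add: laurent_functional_monom)
next
  \<comment> \<open>Additivity is available for \<open>s \<ge> 0\<close> only, so the two functions
    of s are identified in a neighbourhood.\<close>
  have pos: "\<forall>\<^sub>F t in nhds s. t \<in> {0<..}"
    using assms by (intro eventually_nhds_in_open) auto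
  show "?Q (f + g)" if "?Q f" "?Q g" for f g
  proof -
    have "((\<lambda>s. laurent_functional \<alpha> s (pCons 0 f) + laurent_functional \<alpha> s (pCons 0 g))
        has_real_derivative - laurent_functional \<alpha> s (f + g)) (at s)"
      using DERIV_add[OF that] assms by (simp add: laurent_functional_add)
    also have "?this \<longleftrightarrow> ?thesis"
    proof (rule DERIV_cong_ev)
      show "\<forall>\<^sub>F t in nhds s. laurent_functional \<alpha> t (pCons 0 f) + laurent_functional \<alpha> t (pCons 0 g) =
         laurent_functional \<alpha> t (pCons 0 (f + g))"
        using pos by eventually_elim (use assms in \<open>simp add: flip: laurent_functional_add\<close>)
    qed auto
    finally show ?thesis .
  qed
  show "?Q (Polynomial.smult c f)" if "?Q f" for c f
    using DERIV_cmult[OF that, of c] laurent_functional_smult[of \<alpha> _ c "pCons 0 f"]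
    by (simp add: laurent_functional_smult)
qed (auto simp: degree_monom_eq coeff_eq_0 laurent_functional_def weighted_integral_def)

text \<open>Existence and uniqueness together justify the definite description in
  \<open>orth_poly\<close>.\<close>

lemma orth_poly_monic_orthogonal:
  assumes "\<alpha> > 0" "s > 0"
  shows "positive_functional.monic_orthogonal (laurent_functional \<alpha> s) (orth_poly \<alpha> s)"
proof -
  interpret positive_functional "laurent_functional \<alpha> s"
    using assms by (intro positive_functional_laurent) auto
  have eq: "monic_orthogonal_system \<alpha> s P \<longleftrightarrow> monic_orthogonal P" for P
    by (simp add: monic_orthogonal_system_def monic_orthogonal_def ip_def laurent_functional_pCons_0
        poly_mult[abs_def])
  obtain P where P: "monic_orthogonal P" using ex_monic_orthogonal by blast
  then interpret orthogonal_polynomials "laurent_functional \<alpha> s" P by unfold_locales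
  have "monic_orthogonal_system \<alpha> s (orth_poly \<alpha> s)"
    unfolding orth_poly_def by (rule theI[of _ P]) (auto simp: eq P intro: orthogonal_polynomials_unique)
  then show ?thesis by (simp add: eq)
qed

lemma laguerre_polynomials_orth_poly:
  assumes "\<alpha> > 0" "s > 0"
  shows "laguerre_polynomials (laurent_functional \<alpha> s) (orth_poly \<alpha> s) \<alpha> s"
proof -
  interpret positive_functional "laurent_functional \<alpha> s"
    using assms by (intro positive_functional_laurent) auto
  show ?thesis
    by unfold_locales
       (use assms in \<open>auto intro: orth_poly_monic_orthogonal laurent_functional_by_parts\<close>)
qed

section \<open>The Hankel determinant and its derivative\<close>

text \<open>In the Leibniz expansion only the identity permutation contributes to the derivative at
  a point where the matrix is diagonal.\<close>

lemma has_derivative_det_diagonal: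
  fixes g :: "nat \<Rightarrow> nat \<Rightarrow> real \<Rightarrow> real"
  assumes deriv: "\<And>i k. (g i k has_real_derivative g' i k) (at s)"
    and diag: "\<And>i k. i \<noteq> k \<Longrightarrow> g i k s = 0"
  shows "((\<lambda>t. Determinant.det (Matrix.mat n n (\<lambda>(i, k). g i k t))) has_real_derivative
           (\<Sum>i<n. g' i i * (\<Prod>j\<in>{..<n} - {i}. g j j s))) (at s)"
proof -
  let ?D = "\<lambda>p. (\<Sum>i\<in>{0..<n}. g' i (p i) * (\<Prod>j\<in>{0..<n} - {i}. g j (p j) s))"
  have det: "Determinant.det (Matrix.mat n n (\<lambda>(i, k). g i k t)) =
     (\<Sum>p | p permutes {0..<n}. signof p * (\<Prod>i = 0..<n. g i (p i) t))" for t
  proof -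
    have "p i < n" if "p permutes {0..<n}" "i < n" for p i
      using permutes_in_image[OF that(1), of i] that(2) by simp
    then show ?thesis
      by (subst det_def'[of _ n]) (auto intro!: sum.cong prod.cong)
  qed
  \<comment> \<open>a permutation other than the identity contributes at least two vanishing factors\<close>
  have "?D p = 0" if p: "p permutes {0..<n}" "p \<noteq> id" for p
  proof (rule sum.neutral, rule ballI)
    fix i assume i: "i \<in> {0..<n}"
    obtain k where k: "p k \<noteq> k" using p(2) by fastforce
    have "p (p k) \<noteq> p k" using k permutes_inj[OF p(1)] by (auto dest: injD)
    moreover have "k \<in> {0..<n}" using k p(1) by (meson permutes_not_in)
    moreover from this have "p k \<in> {0..<n}" using p(1) by (simp add: permutes_in_image)
    ultimately obtain j where j: "j \<in> {0..<n} - {i}" "p j \<noteq> j"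
      using k by (metis Diff_iff singletonD)
    then have "g j (p j) s = 0" using diag by metis
    then have "(\<Prod>j\<in>{0..<n} - {i}. g j (p j) s) = 0" using j by (intro prod_zero) auto
    then show "g' i (p i) * (\<Prod>j\<in>{0..<n} - {i}. g j (p j) s) = 0" by simp
  qed
  then have "(\<Sum>p | p permutes {0..<n}. signof p * ?D p) =
      (\<Sum>p | p permutes {0..<n}. if p = id then ?D id else 0)"
    by (intro sum.cong) (auto simp: sign_id)
  also have "\<dots> = ?D id"
    by (subst sum.delta) (auto simp: finite_permutations permutes_id)
  finally have D: "(\<Sum>p | p permutes {0..<n}. signof p * ?D p) = ?D id" .
  have "((\<lambda>t. Determinant.det (Matrix.mat n n (\<lambda>(i, k). g i k t))) has_real_derivative
      (\<Sum>p | p permutes {0..<n}. signof p * ?D p)) (at s)"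
    unfolding det by (intro DERIV_sum DERIV_cmult has_field_derivative_prod deriv)
  then show ?thesis unfolding D by (simp add: atLeast0LessThan)
qed

text \<open>The Gram matrix is L H L^T with L the coefficient matrix of the \<open>P i\<close>,
  which is unitriangular. As \<open>P\<close> is any monic sequence, one and the same
  \<open>P\<close> may be used at different values of \<open>s\<close>.\<close>

lemma hankel_det_gram:
  assumes "\<alpha> > 0" "s > 0" and P: "\<And>j. degree (P j) = j \<and> lead_coeff (P j) = 1"
  shows "hankel_det \<alpha> s n =
     Determinant.det (Matrix.mat n n (\<lambda>(i, k). laurent_functional \<alpha> s (pCons 0 (P i * P k))))"
proof -
  interpret positive_functional "laurent_functional \<alpha> s"
    using assms by (intro positive_functional_laurent) auto
  define H where "H = Matrix.mat n n (\<lambda>(j, k). weighted_integral \<alpha> s (\<lambda>x. x ^ (j + k)))"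
  define L where "L = Matrix.mat n n (\<lambda>(i, j). coeff (P i) j)"
  have H: "H \<in> carrier_mat n n" and L: "L \<in> carrier_mat n n" and LT: "transpose_mat L \<in> carrier_mat n n"
    by (auto simp: H_def L_def)
  have entry: "weighted_integral \<alpha> s (\<lambda>x. x ^ (j + k)) = ip (monom 1 j) (monom 1 k)" for j k
    by (simp add: ip_def mult_monom laurent_functional_pCons_0 poly_monom[abs_def])
  have expand: "P i = (\<Sum>j<n. Polynomial.smult (coeff (P i) j) (monom 1 j))" if "i < n" for i
  proof (rule poly_eqI)
    fix m
    have "coeff (\<Sum>j<n. Polynomial.smult (coeff (P i) j) (monom 1 j)) m = (\<Sum>j<n. if j = m then coeff (P i) m else 0)"
      unfolding coeff_sum by (rule sum.cong) auto
    also have "\<dots> = coeff (P i) m" using P[of i] that coeff_eq_0[of "P i" m] by auto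
    finally show "coeff (P i) m = coeff (\<Sum>j<n. Polynomial.smult (coeff (P i) j) (monom 1 j)) m" ..
  qed
  have "L * H * transpose_mat L = Matrix.mat n n (\<lambda>(i, k). ip (P i) (P k))"
  proof (rule eq_matI)
    fix i k assume "i < dim_row (Matrix.mat n n (\<lambda>(i, k). ip (P i) (P k)))"
      "k < dim_col (Matrix.mat n n (\<lambda>(i, k). ip (P i) (P k)))"
    then have ik: "i < n" "k < n" by auto
    have "(L * H * transpose_mat L) $$ (i, k) =
       (\<Sum>l<n. (\<Sum>j<n. coeff (P i) j * ip (monom 1 j) (monom 1 l)) * coeff (P k) l)"
      using ik by (simp add: L_def H_def scalar_prod_def entry atLeast0LessThan)
    also have "\<dots> = ip (\<Sum>j<n. Polynomial.smult (coeff (P i) j) (monom 1 j)) (\<Sum>l<n. Polynomial.smult (coeff (P k) l) (monom 1 l))"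
      unfolding ip_sum_right ip_smult_right ip_sum_left ip_smult_left by (simp add: mult.commute)
    also have "\<dots> = ip (P i) (P k)" using expand[OF ik(1)] expand[OF ik(2)] by simp
    finally show "(L * H * transpose_mat L) $$ (i, k) = Matrix.mat n n (\<lambda>(i, k). ip (P i) (P k)) $$ (i, k)"
      using ik by simp
  qed (auto simp: L_def)
  moreover have "Determinant.det L = 1"
  proof -
    have "Determinant.det L = prod_list (diag_mat L)"
      by (rule det_lower_triangular[OF _ L]) (use P in \<open>auto simp: L_def intro!: coeff_eq_0\<close>)
    also have "\<dots> = (\<Prod>i = 0..<n. coeff (P i) i)"
      unfolding prod_list_diag_prod by (auto simp: L_def intro!: prod.cong)
    also have "\<dots> = 1" by (rule prod.neutral) (use P in metis)
    finally show ?thesis .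
  qed
  moreover have "Determinant.det (L * H * transpose_mat L) = Determinant.det L * Determinant.det H * Determinant.det L"
    by (simp add: det_mult[OF mult_carrier_mat[OF L H] LT] det_mult[OF L H] det_transpose[OF L])
  ultimately show ?thesis by (simp add: hankel_det_def H_def ip_def)
qed

text \<open>At \<open>s\<close> the Gram matrix of the orthogonal polynomials is diagonal with
  entries \<open>h i\<close>, so the determinant is their product and its derivative involves the
  diagonal derivatives alone, given by \<open>laurent_functional_derivative\<close>.\<close>

lemma
  assumes "\<alpha> > 0" "s > 0"
  shows hankel_det_pos: "hankel_det \<alpha> s n > 0"
    and hankel_det_derivative: "((\<lambda>s. hankel_det \<alpha> s n) has_real_derivative
      hankel_det \<alpha> s n * - (\<Sum>j<n. laurent_functional \<alpha> s (orth_poly \<alpha> s j * orth_poly \<alpha> s j) /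
         orthogonal_polynomials.h (laurent_functional \<alpha> s) (orth_poly \<alpha> s) j)) (at s)"
proof -
  interpret laguerre_polynomials "laurent_functional \<alpha> s" "orth_poly \<alpha> s" \<alpha> s
    using assms by (rule laguerre_polynomials_orth_poly)
  let ?P = "orth_poly \<alpha> s" and ?L = "laurent_functional \<alpha>"
  \<comment> \<open>the polynomials stay those of the point \<open>s\<close>; only the functional varies with \<open>t\<close>\<close>
  let ?g = "\<lambda>i k t. ?L t (pCons 0 (?P i * ?P k))"
  have P: "degree (?P j) = j \<and> lead_coeff (?P j) = 1" for j by simp
  have diag: "?g i k s = (if i = k then h i else 0)" for i k
    using orth[of i k] by (auto simp: ip_def h_def)
  have D: "hankel_det \<alpha> s n = (\<Prod>i<n. h i)"
  proof -
    have "hankel_det \<alpha> s n = prod_list (diag_mat (Matrix.mat n n (\<lambda>(i, k). ?g i k s)))"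
      unfolding hankel_det_gram[OF assms P, of n]
      by (rule det_lower_triangular[of n]) (auto simp: diag)
    then show ?thesis
      unfolding prod_list_diag_prod by (auto simp: diag atLeast0LessThan intro!: prod.cong)
  qed
  then show "hankel_det \<alpha> s n > 0" by (auto intro!: prod_pos h_pos)
  have "((\<lambda>t. Determinant.det (Matrix.mat n n (\<lambda>(i, k). ?g i k t))) has_real_derivative
           (\<Sum>i<n. - ?L s (?P i * ?P i) * (\<Prod>j\<in>{..<n} - {i}. ?g j j s))) (at s)"
    by (rule has_derivative_det_diagonal) (auto simp: diag intro: laurent_functional_derivative assms)
  also have "(\<Sum>i<n. - ?L s (?P i * ?P i) * (\<Prod>j\<in>{..<n} - {i}. ?g j j s)) =
      (\<Sum>i<n. - ?L s (?P i * ?P i) / h i * hankel_det \<alpha> s n)"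
  proof (rule sum.cong)
    fix i assume "i \<in> {..<n}"
    then have "hankel_det \<alpha> s n = h i * (\<Prod>j\<in>{..<n} - {i}. h j)"
      unfolding D by (intro prod.remove) auto
    then show "- ?L s (?P i * ?P i) * (\<Prod>j\<in>{..<n} - {i}. ?g j j s) =
       - ?L s (?P i * ?P i) / h i * hankel_det \<alpha> s n"
      using h_pos[of i] by (simp add: diag)
  qed simp
  also have "\<dots> = hankel_det \<alpha> s n * - (\<Sum>j<n. ?L s (?P j * ?P j) / h j)"
    by (simp add: sum_distrib_left sum_negf mult.commute)
  also have "((\<lambda>t. Determinant.det (Matrix.mat n n (\<lambda>(i, k). ?g i k t))) has_real_derivative
      hankel_det \<alpha> s n * - (\<Sum>j<n. ?L s (?P j * ?P j) / h j)) (at s) \<longleftrightarrow>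
      ((\<lambda>t. hankel_det \<alpha> t n) has_real_derivative
      hankel_det \<alpha> s n * - (\<Sum>j<n. ?L s (?P j * ?P j) / h j)) (at s)"
  proof (rule DERIV_cong_ev)
    have "\<forall>\<^sub>F t in nhds s. t \<in> {0<..}"
      using assms by (intro eventually_nhds_in_open) auto
    then show "\<forall>\<^sub>F t in nhds s. Determinant.det (Matrix.mat n n (\<lambda>(i, k). ?g i k t)) = hankel_det \<alpha> t n"
      by eventually_elim (use hankel_det_gram[OF assms(1) _ P] in simp)
  qed auto
  finally show "((\<lambda>s. hankel_det \<alpha> s n) has_real_derivative
      hankel_det \<alpha> s n * - (\<Sum>j<n. ?L s (?P j * ?P j) / h j)) (at s)" .
qed

section \<open>Formal solutions of the linear system\<close>

abbreviation series_entry :: "(nat \<Rightarrow> complex ^ 2 ^ 2) \<Rightarrow> 2 \<Rightarrow> 2 \<Rightarrow> complex fps" where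
  "series_entry \<Phi> i j \<equiv> Abs_fps (\<lambda>k. (if k = 0 then Finite_Cartesian_Product.mat 1 else \<Phi> k) $ i $ j)"

text \<open>
  For \<open>(i, j) = (1, 2)\<close> these are the equations for the first column \<open>(p, r)\<close> of a solution of
  \<open>z\<^sup>2 Y' + Y (a z + b) \<sigma>\<^sub>3 = (M0 z\<^sup>2 + M1 z + b \<sigma>\<^sub>3) Y\<close>; exchanging the indices and negating
  \<open>a\<close> and \<open>b\<close> gives the second column \<open>(r, p)\<close>.
\<close>

definition column_system :: "complex \<Rightarrow> complex \<Rightarrow> complex ^ 2 ^ 2 \<Rightarrow> complex ^ 2 ^ 2 \<Rightarrow> 2 \<Rightarrow> 2 \<Rightarrow>
    complex fps \<Rightarrow> complex fps \<Rightarrow> bool" where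
  "column_system a b M0 M1 i j p r \<longleftrightarrow>
    fps_X * (fps_X * fps_deriv p) + (fps_const a * (fps_X * p) + fps_const b * p) =
      fps_const (M0 $ i $ i) * (fps_X * (fps_X * p)) + fps_const (M1 $ i $ i) * (fps_X * p) + fps_const b * p
      + (fps_const (M0 $ i $ j) * (fps_X * (fps_X * r)) + fps_const (M1 $ i $ j) * (fps_X * r)) \<and>
    fps_X * (fps_X * fps_deriv r) + (fps_const a * (fps_X * r) + fps_const b * r) =
      fps_const (M0 $ j $ i) * (fps_X * (fps_X * p)) + fps_const (M1 $ j $ i) * (fps_X * p)
      + (fps_const (M0 $ j $ j) * (fps_X * (fps_X * r)) + fps_const (M1 $ j $ j) * (fps_X * r) - fps_const b * r)"

text \<open>The coefficient of z in the first equation gives the diagonal entry, that of z in the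
  second gives \<open>fps_nth r 1\<close>, and that of z^2 in the first then gives
  \<open>fps_nth p 1\<close>.\<close>

lemma column_system_first_coeff:
  assumes "column_system a b M0 M1 i j p r" "b \<noteq> 0" "fps_nth p 0 = 1" "fps_nth r 0 = 0"
  shows "M1 $ i $ i = a" "fps_nth p 1 = M0 $ i $ i + M1 $ i $ j * M1 $ j $ i / (2 * b)"
proof -
  note eqs = assms(1)[unfolded column_system_def]
  have "fps_nth (fps_X * (fps_X * fps_deriv p) + (fps_const a * (fps_X * p) + fps_const b * p)) 1 =
    fps_nth (fps_const (M0 $ i $ i) * (fps_X * (fps_X * p)) + fps_const (M1 $ i $ i) * (fps_X * p) + fps_const b * p
      + (fps_const (M0 $ i $ j) * (fps_X * (fps_X * r)) + fps_const (M1 $ i $ j) * (fps_X * r))) 1"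
    by (rule arg_cong[of _ _ "\<lambda>f. fps_nth f 1"]) (rule eqs[THEN conjunct1])
  then show a: "M1 $ i $ i = a" using assms by simp
  have "fps_nth (fps_X * (fps_X * fps_deriv r) + (fps_const a * (fps_X * r) + fps_const b * r)) 1 =
    fps_nth (fps_const (M0 $ j $ i) * (fps_X * (fps_X * p)) + fps_const (M1 $ j $ i) * (fps_X * p)
      + (fps_const (M0 $ j $ j) * (fps_X * (fps_X * r)) + fps_const (M1 $ j $ j) * (fps_X * r) - fps_const b * r)) 1"
    by (rule arg_cong[of _ _ "\<lambda>f. fps_nth f 1"]) (rule eqs[THEN conjunct2])
  then have r1: "b * fps_nth r 1 = M1 $ j $ i - b * fps_nth r 1" using assms by simp
  then have r1: "fps_nth r 1 = M1 $ j $ i / (2 * b)" using assms(2) by (simp add: field_simps)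
  have "fps_nth (fps_X * (fps_X * fps_deriv p) + (fps_const a * (fps_X * p) + fps_const b * p)) 2 =
    fps_nth (fps_const (M0 $ i $ i) * (fps_X * (fps_X * p)) + fps_const (M1 $ i $ i) * (fps_X * p) + fps_const b * p
      + (fps_const (M0 $ i $ j) * (fps_X * (fps_X * r)) + fps_const (M1 $ i $ j) * (fps_X * r))) 2"
    by (rule arg_cong[of _ _ "\<lambda>f. fps_nth f 2"]) (rule eqs[THEN conjunct1])
  then have "fps_nth p 1 + a * fps_nth p 1 = M0 $ i $ i + a * fps_nth p 1 + M1 $ i $ j * fps_nth r 1"
    using assms a by simp
  then show "fps_nth p 1 = M0 $ i $ i + M1 $ i $ j * M1 $ j $ i / (2 * b)"
    unfolding r1 by simp
qed

text \<open>Primitive recursion on pairs of consecutive values; \<open>z\<close> stands for the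
  value at index -1.\<close>

lemma two_step_recursion:
  "\<exists>x. x 0 = x0 \<and> (\<forall>k. x (Suc k) = F k (x k) (if k = 0 then z else x (k - 1)))"
proof -
  define S where "S = rec_nat (x0, z) (\<lambda>k (u, v). (F k u v, u))"
  have "S (Suc k) = (F k (fst (S k)) (snd (S k)), fst (S k))" for k
    by (simp add: S_def split: prod.split)
  moreover have "snd (S k) = (if k = 0 then z else fst (S (k - 1)))" for k
    by (cases k) (simp_all add: S_def split: prod.split)
  ultimately show ?thesis
    by (intro exI[of _ "\<lambda>k. fst (S k)"]) (simp add: S_def)
qed

text \<open>The coefficient of z^(k+1) in the second equation determines the next coefficient of
  \<open>r\<close> because \<open>2 * b\<close> is nonzero; that of z^(k+2) in the first then
  determines the next one of \<open>p\<close> through the factor k + 1, the terms with a p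
  cancelling by \<open>ii\<close>.\<close>

lemma column_system_exists:
  assumes b: "b \<noteq> 0" and ii: "M1 $ i $ i = a" and jj: "M1 $ j $ j = - a"
  shows "\<exists>p r. column_system a b M0 M1 i j p r \<and> fps_nth p 0 = 1 \<and> fps_nth r 0 = 0"
proof -
  \<comment> \<open>\<open>u\<close> and \<open>v\<close> hold the coefficient pairs of (p, r) at
    \<open>k\<close> and \<open>k - 1\<close>; \<open>F\<close> needs the new coefficient
    \<open>R k u v\<close> of \<open>r\<close> before that of \<open>p\<close>.\<close>
  define R where "R = (\<lambda>k (u :: complex \<times> complex) (v :: complex \<times> complex).
    (M0 $ j $ i * fst v + M1 $ j $ i * fst u + M0 $ j $ j * snd v - (2 * a + of_nat k) * snd u) / (2 * b))"
  define F where "F = (\<lambda>k u v. ((M0 $ i $ i * fst u + M0 $ i $ j * snd u + M1 $ i $ j * R k u v) / of_nat (Suc k), R k u v))"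
  obtain x where x: "x 0 = (1, 0)" "\<And>k. x (Suc k) = F k (x k) (if k = 0 then (0, 0) else x (k - 1))"
    using two_step_recursion[of "(1, 0)" F "(0, 0)"] by auto
  define p where "p = Abs_fps (\<lambda>k. fst (x k))"
  define r where "r = Abs_fps (\<lambda>k. snd (x k))"
  have p0: "fps_nth p 0 = 1" and r0: "fps_nth r 0 = 0" by (simp_all add: p_def r_def x)
  have rS: "2 * b * fps_nth r (Suc k) = M0 $ j $ i * (if k = 0 then 0 else fps_nth p (k - 1)) + M1 $ j $ i * fps_nth p k
      + M0 $ j $ j * (if k = 0 then 0 else fps_nth r (k - 1)) - (2 * a + of_nat k) * fps_nth r k" for k
    using b by (simp add: p_def r_def x F_def R_def)
  have pS: "of_nat (Suc k) * fps_nth p (Suc k) = M0 $ i $ i * fps_nth p k + M0 $ i $ j * fps_nth r k + M1 $ i $ j * fps_nth r (Suc k)" for k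
    by (simp add: p_def r_def x(2) F_def del: of_nat_Suc)
  have "column_system a b M0 M1 i j p r"
    unfolding column_system_def
  proof (intro conjI fps_ext)
    fix k
    show "fps_nth (fps_X * (fps_X * fps_deriv p) + (fps_const a * (fps_X * p) + fps_const b * p)) k =
      fps_nth (fps_const (M0 $ i $ i) * (fps_X * (fps_X * p)) + fps_const (M1 $ i $ i) * (fps_X * p) + fps_const b * p
      + (fps_const (M0 $ i $ j) * (fps_X * (fps_X * r)) + fps_const (M1 $ i $ j) * (fps_X * r))) k"
    proof (cases "k < 2")
      case True
      then show ?thesis using r0 ii by (cases k) auto
    next
      case False
      then obtain l where "k = Suc (Suc l)" by (metis add_2_eq_Suc le_Suc_ex not_less)
      then show ?thesis using pS[of l] ii by (simp del: of_nat_Suc add: Suc_eq_plus1[symmetric] del: Suc_eq_plus1)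
    qed
    show "fps_nth (fps_X * (fps_X * fps_deriv r) + (fps_const a * (fps_X * r) + fps_const b * r)) k =
      fps_nth (fps_const (M0 $ j $ i) * (fps_X * (fps_X * p)) + fps_const (M1 $ j $ i) * (fps_X * p)
      + (fps_const (M0 $ j $ j) * (fps_X * (fps_X * r)) + fps_const (M1 $ j $ j) * (fps_X * r) - fps_const b * r)) k"
    proof (cases k)
      case 0
      then show ?thesis using r0 by simp
    next
      case (Suc l)
      show ?thesis
      proof (cases l)
        case 0
        then show ?thesis using Suc rS[of 0] r0 p0 by (simp add: algebra_simps)
      next
        case (Suc m)
        then show ?thesis using \<open>k = Suc l\<close> rS[of l] jj by (simp add: algebra_simps)
      qed
    qed
  qed
  then show ?thesis using p0 r0 by blast
qed

definition standard_system :: "complex \<Rightarrow> complex \<Rightarrow> complex ^ 2 ^ 2 \<Rightarrow> complex ^ 2 ^ 2 \<Rightarrow>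
    (nat \<Rightarrow> complex ^ 2 ^ 2) \<Rightarrow> bool" where
  "standard_system a b M0 M1 \<Phi> \<longleftrightarrow>
     column_system a b M0 M1 1 2 (series_entry \<Phi> 1 1) (series_entry \<Phi> 2 1) \<and>
     column_system (- a) (- b) M0 M1 2 1 (series_entry \<Phi> 2 2) (series_entry \<Phi> 1 2)"

lemma mat_1_component: "(Finite_Cartesian_Product.mat c :: 'a::zero ^ 'n ^ 'n) $ i $ j = (if i = j then c else 0)"
  by (simp add: Finite_Cartesian_Product.mat_def)

text \<open>For the second column \<open>b\<close> changes sign, so in the difference the two
  off-diagonal contributions add up instead of cancelling. This difference is all that the tau form
  uses.\<close>

lemma standard_system_first_coeff:
  assumes "standard_system a b M0 M1 \<Phi>" "b \<noteq> 0"
  shows "M1 $ 1 $ 1 = a" "M1 $ 2 $ 2 = - a"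
    "\<Phi> 1 $ 1 $ 1 - \<Phi> 1 $ 2 $ 2 = M0 $ 1 $ 1 - M0 $ 2 $ 2 + M1 $ 1 $ 2 * M1 $ 2 $ 1 / b"
proof -
  note c1 = column_system_first_coeff[OF assms(1)[unfolded standard_system_def, THEN conjunct1] assms(2)]
  note c2 = column_system_first_coeff[OF assms(1)[unfolded standard_system_def, THEN conjunct2]]
  show "M1 $ 1 $ 1 = a" using c1(1) by (simp add: mat_1_component)
  show "M1 $ 2 $ 2 = - a" using c2(1) assms(2) by (simp add: mat_1_component)
  show "\<Phi> 1 $ 1 $ 1 - \<Phi> 1 $ 2 $ 2 = M0 $ 1 $ 1 - M0 $ 2 $ 2 + M1 $ 1 $ 2 * M1 $ 2 $ 1 / b"
  proof -
    have "\<Phi> 1 $ 1 $ 1 = M0 $ 1 $ 1 + M1 $ 1 $ 2 * M1 $ 2 $ 1 / (2 * b)"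
      using c1(2) by (simp add: mat_1_component)
    moreover have "\<Phi> 1 $ 2 $ 2 = M0 $ 2 $ 2 - M1 $ 1 $ 2 * M1 $ 2 $ 1 / (2 * b)"
      using c2(2) assms(2) by (simp add: mat_1_component mult.commute)
    ultimately show ?thesis using assms(2) by simp
  qed
qed

text \<open>The necessary diagonal conditions of \<open>standard_system_first_coeff\<close> are also
  sufficient.\<close>

lemma standard_system_exists:
  assumes "b \<noteq> 0" "M1 $ 1 $ 1 = a" "M1 $ 2 $ 2 = - a"
  shows "\<exists>\<Phi>. standard_system a b M0 M1 \<Phi>"
proof -
  obtain p r where 1: "column_system a b M0 M1 1 2 p r" "fps_nth p 0 = 1" "fps_nth r 0 = 0"
    using column_system_exists[of b M1 1 a 2 M0] assms by blast
  obtain p' r' where 2: "column_system (- a) (- b) M0 M1 2 1 p' r'" "fps_nth p' 0 = 1" "fps_nth r' 0 = 0"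
    using column_system_exists[of "- b" M1 2 "- a" 1 M0] assms by auto
  let ?\<Phi> = "\<lambda>k. mat22 (fps_nth p k) (fps_nth r' k) (fps_nth r k) (fps_nth p' k)"
  have "series_entry ?\<Phi> 1 1 = p" "series_entry ?\<Phi> 2 1 = r" "series_entry ?\<Phi> 2 2 = p'" "series_entry ?\<Phi> 1 2 = r'"
    using 1 2 by (auto simp: fps_eq_iff mat_1_component mat22_def)
  then have "standard_system a b M0 M1 ?\<Phi>"
    using 1(1) 2(1) by (simp add: standard_system_def)
  then show ?thesis by blast
qed

section \<open>Reduction of the linear system to standard form\<close>

definition pole2_matrix :: "complex ^ 2 ^ 2 \<Rightarrow> complex ^ 2 ^ 2 \<Rightarrow> complex ^ 2 ^ 2 \<Rightarrow> complex fls \<Rightarrow> complex fls ^ 2 ^ 2" where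
  "pole2_matrix M0 M1 M2 lam =
     map_matrix fls_const M0 + map_matrix (\<lambda>a. fls_const a / lam) M1 + map_matrix (\<lambda>a. fls_const a / lam ^ 2) M2"

lemma mat22_component [simp]:
  "mat22 a b c d $ 1 $ 1 = a" "mat22 a b c d $ 1 $ 2 = b" "mat22 a b c d $ 2 $ 1 = c" "mat22 a b c d $ 2 $ 2 = d"
  by (simp_all add: mat22_def)

lemma matrix_mult_2: "(A ** B) $ i $ j = A $ i $ 1 * B $ 1 $ j + A $ i $ 2 * B $ 2 $ j"
  for A B :: "'a::semiring_1 ^ 2 ^ 2"
  by (simp add: matrix_matrix_mult_def sum_2)

lemma map_sigma3_mult: "map_matrix fls_const (sigma3_mult c) = sigma3_mult (fls_const c)"
  by (simp add: Finite_Cartesian_Product.vec_eq_iff forall_2 sigma3_mult_def)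

lemma lax_matrix_eq:
  "lax_matrix \<alpha> n t lam = pole2_matrix (sigma3_mult (- of_real t / 2)) (A_minus1 \<alpha> n t) (A_minus2 \<alpha> n t) lam"
  unfolding lax_matrix_def pole2_matrix_def map_sigma3_mult by simp

lemma matrix_series_component: "matrix_series \<Phi> $ i $ j = fps_to_fls (series_entry \<Phi> i j)"
  by (simp add: matrix_series_def)

lemma inverse_fls_X_inv: "inverse (fls_X_inv :: complex fls) = fls_X"
  using fls_inverse_X[where ?'a = complex] by (metis inverse_inverse_eq)

lemma standard_system_fls_iff:
  fixes \<Phi> :: "nat \<Rightarrow> complex ^ 2 ^ 2"
  defines "y \<equiv> \<lambda>i j. matrix_series \<Phi> $ i $ j" and "c \<equiv> fls_const"
  shows "standard_system a b M0 M1 \<Phi> \<longleftrightarrow>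
    fls_X * (fls_X * fls_deriv (y 1 1)) + c a * (fls_X * y 1 1) =
      c (M0 $ 1 $ 1) * (fls_X * (fls_X * y 1 1)) + c (M1 $ 1 $ 1) * (fls_X * y 1 1)
      + c (M0 $ 1 $ 2) * (fls_X * (fls_X * y 2 1)) + c (M1 $ 1 $ 2) * (fls_X * y 2 1) \<and>
    fls_X * (fls_X * fls_deriv (y 2 1)) + c a * (fls_X * y 2 1) + 2 * c b * y 2 1 =
      c (M0 $ 2 $ 1) * (fls_X * (fls_X * y 1 1)) + c (M1 $ 2 $ 1) * (fls_X * y 1 1)
      + c (M0 $ 2 $ 2) * (fls_X * (fls_X * y 2 1)) + c (M1 $ 2 $ 2) * (fls_X * y 2 1) \<and>
    fls_X * (fls_X * fls_deriv (y 2 2)) - c a * (fls_X * y 2 2) =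
      c (M0 $ 2 $ 2) * (fls_X * (fls_X * y 2 2)) + c (M1 $ 2 $ 2) * (fls_X * y 2 2)
      + c (M0 $ 2 $ 1) * (fls_X * (fls_X * y 1 2)) + c (M1 $ 2 $ 1) * (fls_X * y 1 2) \<and>
    fls_X * (fls_X * fls_deriv (y 1 2)) - c a * (fls_X * y 1 2) - 2 * c b * y 1 2 =
      c (M0 $ 1 $ 2) * (fls_X * (fls_X * y 2 2)) + c (M1 $ 1 $ 2) * (fls_X * y 2 2)
      + c (M0 $ 1 $ 1) * (fls_X * (fls_X * y 1 2)) + c (M1 $ 1 $ 1) * (fls_X * y 1 2)"
  unfolding standard_system_def column_system_def fps_to_fls_eq_iff[symmetric] y_def matrix_series_component c_def
  by (simp add: fls_times_fps_to_fls fls_deriv_fps_to_fls algebra_simps del: fps_to_fls_eq_iff)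

text \<open>Multiplication by x^2 removes the denominators and brings an entry of the linear system
  into the shape of \<open>standard_system_fls_iff\<close>.\<close>

lemma clear_double_pole:
  fixes x :: "'a::field"
  assumes "x \<noteq> 0"
  shows "d + y * (a / x + b / x ^ 2) = (m + n / x + b' / x ^ 2) * y + (m' + n' / x) * r \<longleftrightarrow>
    x * (x * d) + a * (x * y) + b * y = m * (x * (x * y)) + n * (x * y) + b' * y + m' * (x * (x * r)) + n' * (x * r)"
proof -
  have "x * x * (d + y * (a / x + b / x ^ 2)) = x * (x * d) + a * (x * y) + b * y"
    and "x * x * ((m + n / x + b' / x ^ 2) * y + (m' + n' / x) * r) =
      m * (x * (x * y)) + n * (x * y) + b' * y + m' * (x * (x * r)) + n' * (x * r)"
    using assms by (simp_all add: field_simps power2_eq_square)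
  then show ?thesis using assms by (metis mult_left_cancel no_zero_divisors)
qed

text \<open>Here z = \<lambda>, and multiplication by z^2 gives the standard form directly. The
  leading matrix is already diagonal, which is what conjugation by \<open>R\<close>
  achieves.\<close>

lemma formal_solution_zero_iff:
  "formal_solution dlam_zero (pole2_matrix M0 M1 (sigma3_mult b) lam_zero) (matrix_series \<Phi>)
     (sigma3_mult (fls_const a / lam_zero + fls_const b / lam_zero ^ 2)) \<longleftrightarrow>
   standard_system a b M0 M1 \<Phi>"
proof -
  define x where "x = (fls_X :: complex fls)"
  define c where "c = (fls_const :: complex \<Rightarrow> complex fls)"
  define y where "y i j = matrix_series \<Phi> $ i $ j" for i j
  have x: "x \<noteq> 0" by (simp add: x_def)
  have c: "c 0 = 0" "c (- u) = - c u" for u by (simp_all add: c_def)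
  have "formal_solution dlam_zero (pole2_matrix M0 M1 (sigma3_mult b) x) (matrix_series \<Phi>)
     (sigma3_mult (c a / x + c b / x ^ 2)) \<longleftrightarrow>
    fls_deriv (y 1 1) + y 1 1 * (c a / x + c b / x ^ 2) =
      (c (M0 $ 1 $ 1) + c (M1 $ 1 $ 1) / x + c b / x ^ 2) * y 1 1 + (c (M0 $ 1 $ 2) + c (M1 $ 1 $ 2) / x) * y 2 1 \<and>
    fls_deriv (y 2 1) + y 2 1 * (c a / x + c b / x ^ 2) =
      (c (M0 $ 2 $ 2) + c (M1 $ 2 $ 2) / x + (- c b) / x ^ 2) * y 2 1 + (c (M0 $ 2 $ 1) + c (M1 $ 2 $ 1) / x) * y 1 1 \<and>
    fls_deriv (y 2 2) + y 2 2 * ((- c a) / x + (- c b) / x ^ 2) =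
      (c (M0 $ 2 $ 2) + c (M1 $ 2 $ 2) / x + (- c b) / x ^ 2) * y 2 2 + (c (M0 $ 2 $ 1) + c (M1 $ 2 $ 1) / x) * y 1 2 \<and>
    fls_deriv (y 1 2) + y 1 2 * ((- c a) / x + (- c b) / x ^ 2) =
      (c (M0 $ 1 $ 1) + c (M1 $ 1 $ 1) / x + c b / x ^ 2) * y 1 2 + (c (M0 $ 1 $ 2) + c (M1 $ 1 $ 2) / x) * y 2 2"
    unfolding formal_solution_def
    by (simp add: Finite_Cartesian_Product.vec_eq_iff forall_2 matrix_mult_2 pole2_matrix_def sigma3_mult_def
        dlam_zero_def c flip: y_def c_def) (auto simp: algebra_simps)
  also have "\<dots> \<longleftrightarrow> standard_system a b M0 M1 \<Phi>"
    unfolding clear_double_pole[OF x] standard_system_fls_iff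
    unfolding x_def[symmetric] c_def[symmetric] y_def[symmetric]
    by (auto simp: algebra_simps)
  finally show ?thesis
    by (simp only: x_def c_def lam_zero_def)
qed

text \<open>With z = 1 / \<lambda> the derivative is - z^2 d/dz; the sign explains the negated
  parameters, and the coefficients of 1 / \<lambda> and 1 / \<lambda>^2 become those of z and
  z^2.\<close>

lemma formal_solution_inf_iff:
  "formal_solution dlam_inf (pole2_matrix (sigma3_mult (- b)) M1 M2 lam_inf) (matrix_series \<Phi>)
     (sigma3_mult (fls_const a / lam_inf - fls_const b)) \<longleftrightarrow>
   standard_system (- a) b (- M2) (- M1) \<Phi>"
proof -
  have lam: "f / lam_inf = f * fls_X" "f / (lam_inf * lam_inf) = f * fls_X * fls_X" for f :: "complex fls"
    by (simp_all add: lam_inf_def divide_inverse inverse_fls_X_inv)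
  show ?thesis
    unfolding formal_solution_def standard_system_fls_iff
    by (simp add: Finite_Cartesian_Product.vec_eq_iff forall_2 matrix_mult_2 pole2_matrix_def sigma3_mult_def
        dlam_inf_def lam power2_eq_square algebra_simps) (auto simp: algebra_simps eq_neg_iff_add_eq_0)
qed

lemma map_matrix_mult_scalar:
  fixes A B :: "'a::comm_ring_1 ^ 2 ^ 2"
  shows "map_matrix ((*) g) A ** B = map_matrix ((*) g) (A ** B)"
    and "A ** map_matrix ((*) g) B = map_matrix ((*) g) (A ** B)"
  by (simp_all add: Finite_Cartesian_Product.vec_eq_iff forall_2 matrix_mult_2 algebra_simps)

lemma map_matrix_fls_const_mult:
  "map_matrix fls_const (A ** B) = map_matrix fls_const A ** map_matrix fls_const B" for A B :: "complex ^ 2 ^ 2"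
  by (simp add: Finite_Cartesian_Product.vec_eq_iff forall_2 matrix_mult_2 fls_plus_const)

lemma matrix_mult_add_rdistrib: "(A + B) ** C = A ** C + B ** C" for A B :: "'a::semiring_1 ^ 'n ^ 'm"
  by (simp add: matrix_matrix_mult_def Finite_Cartesian_Product.vec_eq_iff distrib_right sum.distrib)

lemma pole2_matrix_conj:
  "map_matrix fls_const Q ** pole2_matrix M0 M1 M2 lam ** map_matrix fls_const R =
    pole2_matrix (Q ** M0 ** R) (Q ** M1 ** R) (Q ** M2 ** R) lam"
proof -
  have "map_matrix (\<lambda>a. fls_const a / f) A = map_matrix ((*) (1 / f)) (map_matrix fls_const A)"
    for A :: "complex ^ 2 ^ 2" and f
    by (simp add: Finite_Cartesian_Product.vec_eq_iff)
  then show ?thesis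
    unfolding pole2_matrix_def
    by (simp only: matrix_add_ldistrib matrix_mult_add_rdistrib map_matrix_mult_scalar map_matrix_fls_const_mult)
qed

text \<open>A constant gauge transformation: the derivative passes through \<open>R\<close>, which
  can then be moved into the coefficient matrices.\<close>

lemma formal_solution_conj_iff:
  fixes R Q :: "complex ^ 2 ^ 2"
  assumes "Q ** R = Finite_Cartesian_Product.mat 1" "R ** Q = Finite_Cartesian_Product.mat 1"
  shows "formal_solution dlam_zero (pole2_matrix M0 M1 M2 lam) (map_matrix fls_const R ** Y) L \<longleftrightarrow>
    formal_solution dlam_zero (pole2_matrix (Q ** M0 ** R) (Q ** M1 ** R) (Q ** M2 ** R) lam) Y L"
proof -
  let ?R = "map_matrix fls_const R" and ?Q = "map_matrix fls_const Q" and ?A = "pole2_matrix M0 M1 M2 lam"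
  have one: "map_matrix fls_const (Finite_Cartesian_Product.mat 1 :: complex ^ 2 ^ 2) = Finite_Cartesian_Product.mat 1"
    by (simp add: Finite_Cartesian_Product.vec_eq_iff forall_2 mat_1_component)
  have QR: "?Q ** ?R = Finite_Cartesian_Product.mat 1" "?R ** ?Q = Finite_Cartesian_Product.mat 1"
    using assms one by (simp_all flip: map_matrix_fls_const_mult)
  have deriv: "map_matrix dlam_zero (?R ** Y) = ?R ** map_matrix dlam_zero Y"
    by (simp add: Finite_Cartesian_Product.vec_eq_iff forall_2 matrix_mult_2 dlam_zero_def)
  let ?S = "map_matrix dlam_zero Y + Y ** L"
  have "formal_solution dlam_zero ?A (?R ** Y) L \<longleftrightarrow> ?R ** ?S = ?A ** (?R ** Y)"
    by (simp add: formal_solution_def deriv matrix_add_ldistrib matrix_mul_assoc)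
  also have "\<dots> \<longleftrightarrow> ?S = ?Q ** ?A ** ?R ** Y"
  proof
    assume "?R ** ?S = ?A ** (?R ** Y)"
    then have "?Q ** (?R ** ?S) = ?Q ** (?A ** (?R ** Y))" by simp
    then show "?S = ?Q ** ?A ** ?R ** Y"
      by (simp add: matrix_mul_assoc QR)
  next
    assume "?S = ?Q ** ?A ** ?R ** Y"
    then have "?R ** ?S = (?R ** ?Q) ** ?A ** ?R ** Y" by (simp only: matrix_mul_assoc)
    then show "?R ** ?S = ?A ** (?R ** Y)"
      by (simp add: QR matrix_mul_assoc)
  qed
  finally show ?thesis
    by (simp add: formal_solution_def pole2_matrix_conj)
qed

section \<open>The coefficient of the tau form\<close>

lemma matrix_inv_unique_mult:
  fixes A B :: "'a::semiring_1 ^ 'n ^ 'n"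
  assumes "A ** B = Finite_Cartesian_Product.mat 1" "B ** A = Finite_Cartesian_Product.mat 1"
  shows "matrix_inv A = B"
proof -
  have "A ** matrix_inv A = Finite_Cartesian_Product.mat 1 \<and> matrix_inv A ** A = Finite_Cartesian_Product.mat 1"
    unfolding matrix_inv_def by (rule someI[of _ B]) (use assms in simp)
  then show ?thesis using assms by (metis matrix_mul_assoc matrix_mul_lid matrix_mul_rid)
qed

text \<open>Each series starts with the identity, so the constant term of Y^(-1) Y' is the first
  coefficient matrix; the simple poles of \<open>dT0\<close> and \<open>dTinf\<close> in the local
  coordinate pick out exactly this term.\<close>

lemma jmu_form_coeff_eq:
  "jmu_form_coeff \<Phi>0 \<Phi>inf =
     (\<Phi>0 1 $ 1 $ 1 - \<Phi>0 1 $ 2 $ 2 + \<Phi>inf 1 $ 1 $ 1 - \<Phi>inf 1 $ 2 $ 2) / 2"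
proof -
  \<comment> \<open>The inverse of det Y, a power series because det Y has constant term 1;
    \<open>Z\<close> is then the inverse of Y by the adjugate formula.\<close>
  define D where "D \<Phi> = inverse (series_entry \<Phi> 1 1 * series_entry \<Phi> 2 2 - series_entry \<Phi> 1 2 * series_entry \<Phi> 2 1)" for \<Phi>
  have D: "(series_entry \<Phi> 1 1 * series_entry \<Phi> 2 2 - series_entry \<Phi> 1 2 * series_entry \<Phi> 2 1) * D \<Phi> = 1" "fps_nth (D \<Phi>) 0 = 1" for \<Phi>
    unfolding D_def by (auto simp: mat_1_component intro!: inverse_mult_eq_1')
  define Z where "Z \<Phi> = mat22 (fps_to_fls (D \<Phi> * series_entry \<Phi> 2 2)) (- fps_to_fls (D \<Phi> * series_entry \<Phi> 1 2))
       (- fps_to_fls (D \<Phi> * series_entry \<Phi> 2 1)) (fps_to_fls (D \<Phi> * series_entry \<Phi> 1 1))" for \<Phi>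
  have inv: "matrix_inv (matrix_series \<Phi>) = Z \<Phi>" for \<Phi>
  proof (rule matrix_inv_unique_mult)
    have fl: "fps_to_fls (series_entry \<Phi> 1 1) * fps_to_fls (series_entry \<Phi> 2 2) * fps_to_fls (D \<Phi>) -
       fps_to_fls (series_entry \<Phi> 1 2) * fps_to_fls (series_entry \<Phi> 2 1) * fps_to_fls (D \<Phi>) = 1"
      using arg_cong[OF D(1)[of \<Phi>], of fps_to_fls]
      by (simp add: left_diff_distrib fls_times_fps_to_fls del: fps_to_fls_eq_iff fps_to_fls_eq_1_iff)
    show "matrix_series \<Phi> ** Z \<Phi> = Finite_Cartesian_Product.mat 1"
      "Z \<Phi> ** matrix_series \<Phi> = Finite_Cartesian_Product.mat 1"
      using fl by (simp_all add: Finite_Cartesian_Product.vec_eq_iff forall_2 matrix_mult_2 matrix_series_component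
          Z_def mat_1_component fls_times_fps_to_fls algebra_simps)
  qed
  \<comment> \<open>The trace of Y^(-1) Y' sigma_3, with the derivative taken in the local
    coordinate; both residues read its constant term.\<close>
  define F where "F \<Phi> = D \<Phi> * (series_entry \<Phi> 2 2 * fps_deriv (series_entry \<Phi> 1 1) - series_entry \<Phi> 1 2 * fps_deriv (series_entry \<Phi> 2 1))
     - D \<Phi> * (series_entry \<Phi> 1 1 * fps_deriv (series_entry \<Phi> 2 2) - series_entry \<Phi> 2 1 * fps_deriv (series_entry \<Phi> 1 2))" for \<Phi>
  have F0: "fps_nth (F \<Phi>) 0 = \<Phi> 1 $ 1 $ 1 - \<Phi> 1 $ 2 $ 2" for \<Phi>
    by (simp add: F_def D mat_1_component)
  have tr0: "trace (matrix_inv (matrix_series \<Phi>) ** map_matrix dlam_zero (matrix_series \<Phi>) ** sigma3_mult g) = g * fps_to_fls (F \<Phi>)"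
    for \<Phi> g
    by (simp add: inv trace_def sum_2 matrix_mult_2 matrix_series_component Z_def F_def sigma3_mult_def dlam_zero_def
        fls_times_fps_to_fls fls_deriv_fps_to_fls algebra_simps)
  have tri: "trace (matrix_inv (matrix_series \<Phi>) ** map_matrix dlam_inf (matrix_series \<Phi>) ** sigma3_mult g) =
      - (fls_X ^ 2 * g) * fps_to_fls (F \<Phi>)" for \<Phi> g
    by (simp add: inv trace_def sum_2 matrix_mult_2 matrix_series_component Z_def F_def sigma3_mult_def dlam_inf_def
        fls_times_fps_to_fls fls_deriv_fps_to_fls algebra_simps)
  define e :: "complex fls" where "e = fls_const (1 / 2)"
  have "inverse (fls_const 2 :: complex fls) = e"
    unfolding fls_inverse_const e_def by simp
  then have inv_two: "inverse (2 :: complex fls) = e" by simp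
  have half: "- 1 / (2 * lam_zero) * f = fls_X_inv * (- e * f)" for f :: "complex fls"
    by (simp only: lam_zero_def divide_inverse inverse_mult_distrib inv_two fls_inverse_X
        mult_minus_left mult_minus_right mult_1 mult_1_right mult_ac)
  have XX: "fls_X * fls_X_inv = (1 :: complex fls)"
    by (metis fls_X_nonzero fls_inverse_X right_inverse)
  have half': "- (fls_X ^ 2 * (- lam_inf / 2)) * f = fls_X * (e * f)" for f :: "complex fls"
  proof -
    have "- (fls_X ^ 2 * (- lam_inf / 2)) * f = (fls_X * fls_X_inv) * (fls_X * (e * f))"
      by (simp only: lam_inf_def divide_inverse inv_two power2_eq_square
          mult_minus_left mult_minus_right minus_minus mult_ac)
    then show ?thesis by (simp only: XX mult_1)
  qed
  show ?thesis
    unfolding jmu_form_coeff_def Let_def tr0 tri half half' res_zero_def res_inf_def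
    by (simp add: F0 e_def fls_X_inv_times_conv_shift(1) fls_X_times_conv_shift(1)
        diff_divide_distrib add_divide_distrib)
qed

lemma trace_sigma3_mult: "trace (sigma3_mult c ** M) = c * (M $ 1 $ 1 - M $ 2 $ 2)"
  by (simp add: trace_def sum_2 matrix_mult_2 sigma3_mult_def algebra_simps)

text \<open>With c sigma_3 conjugated to \<open>A_minus2\<close>, this expresses diagonal data of
  the conjugated system through the given matrices, without reference to \<open>R\<close>.\<close>

lemma trace_sigma3_conj:
  fixes R Q M :: "complex ^ 2 ^ 2"
  shows "c * ((Q ** M ** R) $ 1 $ 1 - (Q ** M ** R) $ 2 $ 2) = trace (R ** sigma3_mult c ** Q ** M)"
proof -
  have "trace (sigma3_mult c ** (Q ** M ** R)) = trace ((sigma3_mult c ** Q ** M) ** R)"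
    by (simp only: matrix_mul_assoc)
  also have "\<dots> = trace (R ** (sigma3_mult c ** Q ** M))"
    by (rule trace_mul_sym)
  finally show ?thesis
    by (simp only: trace_sigma3_mult[of c "Q ** M ** R", symmetric] matrix_mul_assoc)
qed

lemma det_conj:
  fixes R Q M :: "'a::comm_ring_1 ^ 'n ^ 'n"
  assumes "Q ** R = Finite_Cartesian_Product.mat 1"
  shows "Determinants.det (Q ** M ** R) = Determinants.det M"
proof -
  have "Determinants.det Q * Determinants.det R = 1"
    using det_mul[of Q R] assms by simp
  then show ?thesis by (simp add: det_mul mult.commute mult.left_commute)
qed

lemma formal_solution_inf_standard:
  "formal_solution_inf \<alpha> n t \<Phi> \<longleftrightarrow>
     standard_system (of_real (theta_inf \<alpha> n / 2)) (of_real t / 2) (- A_minus2 \<alpha> n t) (- A_minus1 \<alpha> n t) \<Phi>"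
  using formal_solution_inf_iff[of "of_real t / 2" "A_minus1 \<alpha> n t" "A_minus2 \<alpha> n t" \<Phi> "of_real (- theta_inf \<alpha> n / 2)"]
  by (simp add: formal_solution_inf_def lax_matrix_eq exponent_deriv_inf_def)

lemma formal_solution_zero_standard:
  assumes QR: "Q ** R = Finite_Cartesian_Product.mat 1" "R ** Q = Finite_Cartesian_Product.mat 1"
  shows "formal_solution_zero \<alpha> n t R \<Phi> \<longleftrightarrow>
    Determinants.det R = 1 \<and> R ** sigma3_mult (of_real t / 2) ** Q = A_minus2 \<alpha> n t \<and>
    standard_system (of_real (\<alpha> / 2)) (of_real t / 2) (Q ** sigma3_mult (- of_real t / 2) ** R) (Q ** A_minus1 \<alpha> n t ** R) \<Phi>"
proof -
  have "matrix_inv R = Q" using QR by (intro matrix_inv_unique_mult)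
  moreover have "Q ** A_minus2 \<alpha> n t ** R = sigma3_mult (of_real t / 2)"
    if "R ** sigma3_mult (of_real t / 2) ** Q = A_minus2 \<alpha> n t"
  proof -
    have "Q ** (R ** sigma3_mult (of_real t / 2) ** Q) ** R = (Q ** R) ** sigma3_mult (of_real t / 2) ** (Q ** R)"
      by (simp only: matrix_mul_assoc)
    then show ?thesis using that QR by simp
  qed
  ultimately show ?thesis
    unfolding formal_solution_zero_def lax_matrix_eq exponent_deriv_zero_def theta_zero_def
      formal_solution_conj_iff[OF QR]
    by (auto simp: formal_solution_zero_iff)
qed

text \<open>At zero the conjugate of \<open>A_minus1\<close> has diagonal entries \<alpha> / 2 and -
  \<alpha> / 2 and an unchanged determinant, which fixes the product of its off-diagonal entries;
  the rest is a trace with \<open>A_minus2\<close>. Hence the value is the same for every choice of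
  formal solutions.\<close>

lemma jmu_form_coeff_formal_solutions:
  assumes "formal_solution_inf \<alpha> n t \<Phi>inf" "formal_solution_zero \<alpha> n t R \<Phi>0" "t \<noteq> 0"
  shows "jmu_form_coeff \<Phi>0 \<Phi>inf = - 2 * zeta_fun \<alpha> n t - of_real t
    + (of_real (real n * (real n + \<alpha>)) + 2 * u_fun \<alpha> n t * v_fun \<alpha> n t) / of_real t"
proof -
  define b where "b = complex_of_real t / 2"
  have b: "b \<noteq> 0" using assms by (simp add: b_def)
  have t: "complex_of_real t = 2 * b" by (simp add: b_def)
  let ?A1 = "A_minus1 \<alpha> n t" and ?A2 = "A_minus2 \<alpha> n t"
  let ?u = "u_fun \<alpha> n t" and ?v = "v_fun \<alpha> n t" and ?\<zeta> = "zeta_fun \<alpha> n t"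
  have inf: "\<Phi>inf 1 $ 1 $ 1 - \<Phi>inf 1 $ 2 $ 2 = - 2 * ?\<zeta> - 2 * b + ?u * ?v / b"
    using standard_system_first_coeff(3)[OF assms(1)[unfolded formal_solution_inf_standard, folded b_def] b]
    by (simp add: A_minus1_def A_minus2_def Let_def t)
  have "Determinants.det R = 1" using assms(2) by (simp add: formal_solution_zero_def)
  then obtain Q where Q: "Q ** R = Finite_Cartesian_Product.mat 1" "R ** Q = Finite_Cartesian_Product.mat 1"
    by (metis invertible_det_nz invertible_def zero_neq_one)
  let ?S = "Q ** sigma3_mult (- b) ** R" and ?B = "Q ** ?A1 ** R"
  have R: "R ** sigma3_mult b ** Q = ?A2"
    and std: "standard_system (of_real (\<alpha> / 2)) b ?S ?B \<Phi>0"
    using assms(2)[unfolded formal_solution_zero_standard[OF Q]] by (simp_all add: b_def)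
  have "b * (?S $ 1 $ 1 - ?S $ 2 $ 2) = trace (?A2 ** sigma3_mult (- b))"
    unfolding trace_sigma3_conj R ..
  also have "\<dots> = b * (- 2 * ?\<zeta> - 2 * b)"
    by (simp only: trace_mul_sym[of ?A2] trace_sigma3_mult)
       (simp add: A_minus2_def Let_def t algebra_simps)
  finally have S: "?S $ 1 $ 1 - ?S $ 2 $ 2 = - 2 * ?\<zeta> - 2 * b" using b by simp
  have "Determinants.det ?B = Determinants.det ?A1" by (rule det_conj) (rule Q)
  moreover have "Determinants.det ?A1 = - (of_real (theta_inf \<alpha> n / 2))\<^sup>2 - ?u * ?v"
    by (simp add: det_2 A_minus1_def power2_eq_square)
  moreover have "Determinants.det ?B = - (of_real (\<alpha> / 2))\<^sup>2 - ?B $ 1 $ 2 * ?B $ 2 $ 1"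
    unfolding det_2 standard_system_first_coeff(1,2)[OF std b] power2_eq_square by simp
  ultimately have "?B $ 1 $ 2 * ?B $ 2 $ 1 = of_real ((theta_inf \<alpha> n / 2)\<^sup>2 - (\<alpha> / 2)\<^sup>2) + ?u * ?v"
    by (simp add: algebra_simps)
  also have "(theta_inf \<alpha> n / 2)\<^sup>2 - (\<alpha> / 2)\<^sup>2 = real n * (real n + \<alpha>)"
    by (simp add: theta_inf_def power2_eq_square field_simps)
  finally have B: "?B $ 1 $ 2 * ?B $ 2 $ 1 = of_real (real n * (real n + \<alpha>)) + ?u * ?v" .
  have "\<Phi>0 1 $ 1 $ 1 - \<Phi>0 1 $ 2 $ 2 = - 2 * ?\<zeta> - 2 * b + (of_real (real n * (real n + \<alpha>)) + ?u * ?v) / b"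
    unfolding standard_system_first_coeff(3)[OF std b] S B ..
  then have "jmu_form_coeff \<Phi>0 \<Phi>inf = ((- 2 * ?\<zeta> - 2 * b + (of_real (real n * (real n + \<alpha>)) + ?u * ?v) / b)
      + (- 2 * ?\<zeta> - 2 * b + ?u * ?v / b)) / 2"
    unfolding inf[symmetric] by (simp add: jmu_form_coeff_eq)
  also have "\<dots> = - 2 * ?\<zeta> - 2 * b + (of_real (real n * (real n + \<alpha>)) + 2 * ?u * ?v) / (2 * b)"
    using b by (simp add: field_simps)
  finally show ?thesis by (simp add: t)
qed

text \<open>At infinity the diagonal condition holds by the form of \<open>A_minus1\<close>. At zero
  the conjugated matrix must have diagonal entries \<alpha> / 2 and - \<alpha> / 2: their sum is 0
  because \<open>A_minus1\<close> is traceless, and their difference comes from \<open>tr\<close> by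
  \<open>trace_sigma3_conj\<close>.\<close>

lemma formal_solutions_exist:
  assumes t: "t \<noteq> 0" and \<omega>: "omega_fun \<alpha> n t \<noteq> 0"
    and tr: "trace (A_minus2 \<alpha> n t ** A_minus1 \<alpha> n t) = of_real (\<alpha> * t / 2)"
  shows "\<exists>\<Phi>inf R \<Phi>0. formal_solution_inf \<alpha> n t \<Phi>inf \<and> formal_solution_zero \<alpha> n t R \<Phi>0"
proof -
  define b where "b = complex_of_real t / 2"
  have b: "b \<noteq> 0" using assms by (simp add: b_def)
  have t2: "complex_of_real t = 2 * b" by (simp add: b_def)
  let ?A1 = "A_minus1 \<alpha> n t" and ?A2 = "A_minus2 \<alpha> n t"
  define \<omega> where "\<omega> = omega_fun \<alpha> n t"
  define \<zeta> where "\<zeta> = zeta_fun \<alpha> n t"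
  have w: "\<omega> \<noteq> 0" using assms by (simp add: \<omega>_def)
  \<comment> \<open>\<open>e\<close> is \<zeta> / t, and \<open>f\<close> is then forced by det R =
    1, that is, \<omega> f - e = 1.\<close>
  define e where "e = \<zeta> / (2 * b)"
  define f where "f = (e + 1) / \<omega>"
  have \<zeta>: "\<zeta> = 2 * b * e" using b by (simp add: e_def)
  have wf: "\<omega> * f = e + 1" "f * \<omega> = e + 1" using w by (simp_all add: f_def)
  have quot: "(2 * b * e + 2 * b) / \<omega> = 2 * b * f"
    unfolding f_def by (simp add: distrib_left)
  \<comment> \<open>the columns of \<open>R\<close> are eigenvectors of \<open>A\<^bsub>-2\<^esub>\<close> for \<open>t/2\<close> and \<open>-t/2\<close>\<close>
  define R where "R = mat22 \<omega> e 1 f"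
  define Q where "Q = mat22 f (- e) (- 1) \<omega>"
  have Q: "Q ** R = Finite_Cartesian_Product.mat 1" "R ** Q = Finite_Cartesian_Product.mat 1"
    by (simp_all add: Finite_Cartesian_Product.vec_eq_iff forall_2 matrix_mult_2 R_def Q_def mat_1_component wf)
  have det: "Determinants.det R = 1"
    by (simp add: det_2 R_def wf)
  have "\<omega> * b * f = b * (\<omega> * f)" "f * b * \<omega> = b * (\<omega> * f)"
    by (simp_all only: mult_ac)
  then have bwf: "\<omega> * b * f = b * e + b" "f * b * \<omega> = b * e + b"
    by (simp_all add: wf distrib_left)
  have A2: "?A2 = mat22 (2 * b * e + b) (- \<omega> * (2 * b * e)) (2 * b * f) (- (2 * b * e) - b)"
    unfolding A_minus2_def Let_def t2 \<omega>_def[symmetric] \<zeta>_def[symmetric] \<zeta> quot by simp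
  have R: "R ** sigma3_mult b ** Q = ?A2"
    unfolding A2 by (simp add: Finite_Cartesian_Product.vec_eq_iff forall_2 matrix_mult_2 R_def Q_def sigma3_mult_def)
      (simp add: bwf)
  let ?B = "Q ** ?A1 ** R"
  have "b * (?B $ 1 $ 1 - ?B $ 2 $ 2) = b * of_real \<alpha>"
    unfolding trace_sigma3_conj R tr by (simp add: b_def)
  then have "?B $ 1 $ 1 - ?B $ 2 $ 2 = of_real \<alpha>" using b by simp
  moreover have "trace ?B = 0"
  proof -
    have "trace (Q ** ?A1 ** R) = trace (R ** (Q ** ?A1))" by (rule trace_mul_sym)
    also have "R ** (Q ** ?A1) = ?A1" by (simp add: matrix_mul_assoc Q)
    finally show ?thesis by (simp add: trace_def sum_2 A_minus1_def)
  qed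
  then have "?B $ 1 $ 1 + ?B $ 2 $ 2 = 0" by (simp add: trace_def sum_2)
  moreover have "x = a / 2 \<and> y = - (a / 2)" if "x - y = a" "x + y = 0" for x y a :: complex
  proof -
    have "y = - x" using that(2) by (simp add: add_eq_0_iff)
    then show ?thesis using that(1) by auto
  qed
  ultimately have "?B $ 1 $ 1 = of_real \<alpha> / 2" "?B $ 2 $ 2 = - (of_real \<alpha> / 2)"
    by blast+
  then have "?B $ 1 $ 1 = of_real (\<alpha> / 2)" "?B $ 2 $ 2 = - of_real (\<alpha> / 2)"
    by simp_all
  then obtain \<Phi>0 where "standard_system (of_real (\<alpha> / 2)) b (Q ** sigma3_mult (- b) ** R) ?B \<Phi>0"
    using standard_system_exists[OF b] by blast
  then have "formal_solution_zero \<alpha> n t R \<Phi>0"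
    unfolding formal_solution_zero_standard[OF Q] using det R by (simp add: b_def)
  moreover obtain \<Phi>inf where "standard_system (of_real (theta_inf \<alpha> n / 2)) b (- ?A2) (- ?A1) \<Phi>inf"
    using standard_system_exists[OF b, of "- ?A1" "of_real (theta_inf \<alpha> n / 2)" "- ?A2"]
    by (auto simp: A_minus1_def)
  then have "formal_solution_inf \<alpha> n t \<Phi>inf"
    by (simp add: formal_solution_inf_standard b_def)
  ultimately show ?thesis by blast
qed

section \<open>The linear system in terms of the orthogonal polynomials\<close>

context laguerre_polynomials
begin

text \<open>\<open>pq m\<close> is the product \<open>p\<^sub>n q\<^sub>n\<close> for \<open>n = Suc m\<close>.\<close>

definition pq :: "nat \<Rightarrow> real" where "pq m = poly (P m) 0 * I (Suc m) / h m"

text \<open>\<open>residue_identity\<close> divided by \<open>h m\<close>, after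
  \<open>N_P_P_Suc\<close> has rewritten \<open>1 - pq m\<close> through \<open>I m\<close>.\<close>

lemma trace_identity:
  "real (Suc m) + h (Suc m) / h m * (poly (P m) 0 / poly (P (Suc m)) 0) * (1 - pq m) =
     (2 * real (Suc m) + \<alpha> + poly (P (Suc m)) 0 / poly (P m) 0) * pq m"
proof -
  define A B where "A = poly (P m) 0" and "B = poly (P (Suc m)) 0"
  have nz: "A \<noteq> 0" "B \<noteq> 0" "h m \<noteq> 0" using P_at_0_nz h_pos[of m] by (auto simp: A_def B_def)
  have *: "A * I (Suc m) = h m + B * I m"
    using N_P_P_Suc[of m] by (simp add: A_def B_def)
  have "1 - pq m = - B * I m / h m"
    using * nz by (simp add: pq_def field_simps flip: A_def)
  then have 1: "h (Suc m) / h m * (A / B) * (1 - pq m) = - (h (Suc m) / h m * (A * I m)) / h m"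
    using nz by simp
  have 2: "B / A * pq m = B * I (Suc m) / h m"
    using nz by (simp add: pq_def flip: A_def)
  have "real (Suc m) * h m = B * I (Suc m) + h (Suc m) / h m * (A * I m) + (2 * real (Suc m) + \<alpha>) * (A * I (Suc m))"
    using residue_identity[of "Suc m" m] by (simp add: A_def B_def)
  then have "real (Suc m) = (B * I (Suc m) + h (Suc m) / h m * (A * I m) + (2 * real (Suc m) + \<alpha>) * (A * I (Suc m))) / h m"
    using nz by (simp add: nonzero_eq_divide_eq)
  also have "\<dots> = B * I (Suc m) / h m + h (Suc m) / h m * (A * I m) / h m + (2 * real (Suc m) + \<alpha>) * pq m"
    by (simp add: add_divide_distrib pq_def A_def)
  finally show ?thesis
    unfolding A_def[symmetric] B_def[symmetric] 1 distrib_right 2 by simp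
qed

end

lemma orth_poly_quantities:
  assumes "\<alpha> > 0" "s > 0"
  defines "N \<equiv> laurent_functional \<alpha> s" and "P \<equiv> orth_poly \<alpha> s"
  shows sq_norm_h_eq: "sq_norm_h \<alpha> s j = orthogonal_polynomials.h N P j"
    and p_fun_eq: "p_fun \<alpha> s n = of_real (poly (P n) 0 * orthogonal_polynomials.I N P n) / (2 * of_real pi * \<i>)"
proof -
  interpret laguerre_polynomials N P \<alpha> s
    unfolding N_def P_def using assms by (intro laguerre_polynomials_orth_poly)
  show "sq_norm_h \<alpha> s j = h j"
  proof -
    have "h j = N (pCons 0 (P j * P j))" by (simp add: h_def ip_def)
    then show ?thesis
      by (simp add: sq_norm_h_def N_def P_def laurent_functional_pCons_0 poly_mult[abs_def] power2_eq_square)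
  qed
  show "p_fun \<alpha> s n = of_real (poly (P n) 0 * I n) / (2 * of_real pi * \<i>)"
  proof -
    have "I n = N (P n)" by (simp add: I_def)
    then show ?thesis by (simp add: p_fun_def N_def P_def laurent_functional_def)
  qed
qed

text \<open>In \<zeta>, u v, u / \<omega> and v \<omega> the factors 2 pi i and the powers t^(2n +
  \<alpha>) cancel, which leaves real expressions in the orthogonal polynomials.\<close>

lemma linear_system_quantities:
  assumes "\<alpha> > 0" "t > 0"
  defines "N \<equiv> laurent_functional \<alpha> (t\<^sup>2)" and "P \<equiv> orth_poly \<alpha> (t\<^sup>2)"
  defines h_eq: "h \<equiv> orthogonal_polynomials.h N P" and "y \<equiv> laguerre_polynomials.pq N P"
  shows zeta_fun_eq: "zeta_fun \<alpha> (Suc m) t = of_real (- t * y m)"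
    and uv_eq: "u_fun \<alpha> (Suc m) t * v_fun \<alpha> (Suc m) t = of_real (- (h (Suc m) / h m))"
    and omega_fun_nz: "omega_fun \<alpha> (Suc m) t \<noteq> 0"
    and trace_A: "trace (A_minus2 \<alpha> (Suc m) t ** A_minus1 \<alpha> (Suc m) t) = of_real (\<alpha> * t / 2)"
proof -
  have s: "t\<^sup>2 > 0" using assms by simp
  interpret laguerre_polynomials N P \<alpha> "t\<^sup>2"
    unfolding N_def P_def using assms(1) s by (rule laguerre_polynomials_orth_poly)
  note sq = sq_norm_h_eq[OF assms(1) s, folded N_def P_def]
  note p = p_fun_eq[OF assms(1) s, folded N_def P_def]
  let ?u = "u_fun \<alpha> (Suc m) t" and ?v = "v_fun \<alpha> (Suc m) t"
  let ?\<zeta> = "zeta_fun \<alpha> (Suc m) t" and ?\<omega> = "omega_fun \<alpha> (Suc m) t"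
  define A B where "A = poly (P m) 0" and "B = poly (P (Suc m)) 0"
  define c where "c = 2 * of_real pi * \<i>"
  define w where "w = t powr (2 * real (Suc m) + \<alpha>)"
  have nz: "A \<noteq> 0" "B \<noteq> 0" "h m \<noteq> 0" "h (Suc m) \<noteq> 0" "c \<noteq> 0" "w \<noteq> 0"
    using P_at_0_nz h_pos[of m] h_pos[of "Suc m"] assms by (auto simp: A_def B_def c_def w_def h_eq)
  have w': "t powr (- 2 * real (Suc m) - \<alpha>) = 1 / w"
    unfolding w_def by (simp add: powr_minus_divide[symmetric])
  have q: "q_fun \<alpha> (t\<^sup>2) (Suc m) = c / of_real (h m) * of_real (A / B)"
    unfolding q_fun_def sq P_def[symmetric] by (simp add: h_eq c_def A_def B_def)
  have p: "p_fun \<alpha> (t\<^sup>2) (Suc m) = of_real (B * I (Suc m)) / c"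
    by (simp add: p c_def B_def)
  have u: "?u = - (of_real (h (Suc m)) / c) / of_real w"
    unfolding u_fun_def w' by (simp add: sq h_eq c_def)
  have v: "?v = c / of_real (h m) * of_real w"
    unfolding v_fun_def w_def by (simp add: sq h_eq c_def)
  have om: "?\<omega> = - (of_real (h m * B) / (c * of_real (A * w)))"
    unfolding omega_fun_def w' q using nz by simp
  show zeta: "?\<zeta> = of_real (- t * y m)"
    unfolding zeta_fun_def p q using nz by (simp add: y_def pq_def A_def h_eq)
  show "?u * ?v = of_real (- (h (Suc m) / h m))"
    unfolding u v using nz by simp
  show om_nz: "?\<omega> \<noteq> 0" unfolding om using nz by simp
  \<comment> \<open>The trace couples the off-diagonal entries of the two matrices crosswise, so
    \<open>u\<close> and \<open>v\<close> enter it only through u / \<omega> and v \<omega>.\<close>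
  have uo: "?u / ?\<omega> = of_real (h (Suc m) / h m * (A / B))"
    unfolding u om using nz by (simp add: field_simps)
  have vo: "?v * ?\<omega> = of_real (- (B / A))"
    unfolding v om using nz by (simp add: field_simps)
  have "trace (A_minus2 \<alpha> (Suc m) t ** A_minus1 \<alpha> (Suc m) t) =
     of_real (- theta_inf \<alpha> (Suc m)) * (?\<zeta> + of_real t / 2) - (?v * ?\<omega>) * ?\<zeta> + (?u / ?\<omega>) * (?\<zeta> + of_real t)"
    by (simp add: trace_def sum_2 matrix_mult_2 A_minus1_def A_minus2_def Let_def algebra_simps add_divide_distrib)
  also have "\<dots> = of_real ((2 * real (Suc m) + \<alpha>) * (t / 2 - t * y m) - (B / A) * (t * y m)
      + h (Suc m) / h m * (A / B) * (t - t * y m))"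
    unfolding uo vo zeta by (simp add: theta_inf_def algebra_simps)
  also have "(2 * real (Suc m) + \<alpha>) * (t / 2 - t * y m) - (B / A) * (t * y m)
      + h (Suc m) / h m * (A / B) * (t - t * y m) =
      t * ((real (Suc m) + h (Suc m) / h m * (A / B) * (1 - y m)) - (2 * real (Suc m) + \<alpha> + B / A) * y m) + \<alpha> * t / 2"
    by (simp add: algebra_simps add_divide_distrib)
  also have "\<dots> = \<alpha> * t / 2"
    using trace_identity[of m] unfolding A_def B_def y_def h_eq by simp
  finally show "trace (A_minus2 \<alpha> (Suc m) t ** A_minus1 \<alpha> (Suc m) t) = of_real (\<alpha> * t / 2)" .
qed

section \<open>Comparison of the logarithmic derivatives\<close>

text \<open>The closed form of \<open>jmu_form_coeff\<close> for n = \<open>Suc m\<close>, kept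
  real-valued so that it can be compared with the real Hankel determinant.\<close>

definition log_tau_deriv :: "real \<Rightarrow> nat \<Rightarrow> real \<Rightarrow> real" where
  "log_tau_deriv \<alpha> m t =
     (let N = laurent_functional \<alpha> (t\<^sup>2); P = orth_poly \<alpha> (t\<^sup>2); h = orthogonal_polynomials.h N P;
          n = real (Suc m)
      in 2 * t * laguerre_polynomials.pq N P m - t + (n * (n + \<alpha>) - 2 * (h (Suc m) / h m)) / t)"

lemma jmu_form_coeff_eq_log_tau_deriv:
  assumes "\<alpha> > 0" "t > 0"
    and "formal_solution_inf \<alpha> (Suc m) t \<Phi>inf" "formal_solution_zero \<alpha> (Suc m) t R \<Phi>0"
  shows "jmu_form_coeff \<Phi>0 \<Phi>inf = of_real (log_tau_deriv \<alpha> m t)"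
  using jmu_form_coeff_formal_solutions[OF assms(3,4)] assms(2)
  by (simp add: zeta_fun_eq[OF assms(1,2)] mult.assoc uv_eq[OF assms(1,2)] log_tau_deriv_def Let_def
      del: of_nat_Suc)

text \<open>The asserted formula solved for tau, with C = 1 and s = t^2.\<close>

definition hankel_tau :: "real \<Rightarrow> nat \<Rightarrow> real \<Rightarrow> real" where
  "hankel_tau \<alpha> n t = hankel_det \<alpha> (t\<^sup>2) n * exp (- t\<^sup>2 / 2) * t powr (- (real n * (real n + \<alpha>)))"

lemma hankel_tau_pos: "\<alpha> > 0 \<Longrightarrow> t > 0 \<Longrightarrow> hankel_tau \<alpha> n t > 0"
  by (simp add: hankel_tau_def hankel_det_pos)

text \<open>The chain rule at s = t^2 turns \<open>log_derivative_identity\<close> into a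
  t-derivative; the exponential and the power contribute - t and - k / t.\<close>

lemma hankel_tau_derivative:
  assumes "\<alpha> > 0" "t > 0"
  shows "(hankel_tau \<alpha> (Suc m) has_real_derivative hankel_tau \<alpha> (Suc m) t * log_tau_deriv \<alpha> m t) (at t)"
proof -
  have s: "t\<^sup>2 > 0" using assms by simp
  define N where "N = laurent_functional \<alpha> (t\<^sup>2)"
  define P where "P = orth_poly \<alpha> (t\<^sup>2)"
  interpret laguerre_polynomials N P \<alpha> "t\<^sup>2"
    unfolding N_def P_def using assms(1) s by (rule laguerre_polynomials_orth_poly)
  define n where "n = real (Suc m)"
  define k where "k = n * (n + \<alpha>)"
  define D where "D = hankel_det \<alpha> (t\<^sup>2) (Suc m)"
  define S where "S = (\<Sum>j<Suc m. N (P j * P j) / h j)"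
  have S: "- S * t\<^sup>2 = t\<^sup>2 * pq m + k - h (Suc m) / h m"
    using log_derivative_identity[of "Suc m" m, folded S_def]
    by (simp add: pq_def k_def n_def mult.commute del: of_nat_Suc)
  have "((\<lambda>s. hankel_det \<alpha> s (Suc m)) has_real_derivative D * - S) (at (t\<^sup>2))"
    using hankel_det_derivative[OF assms(1) s, of "Suc m"]
    unfolding D_def S_def N_def P_def .
  then have 1: "((\<lambda>t. hankel_det \<alpha> (t\<^sup>2) (Suc m)) has_real_derivative D * - S * (2 * t)) (at t)"
    by (rule DERIV_chain2[where g = "\<lambda>t. t\<^sup>2"]) (auto intro!: derivative_eq_intros)
  have 2: "((\<lambda>t. exp (- t\<^sup>2 / 2)) has_real_derivative exp (- t\<^sup>2 / 2) * - t) (at t)"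
    by (auto intro!: derivative_eq_intros)
  have "((\<lambda>t. t powr (- k)) has_real_derivative - k * t powr (- k - 1)) (at t)"
    using assms(2) by (rule has_real_derivative_powr)
  then have 3: "((\<lambda>t. t powr (- k)) has_real_derivative t powr (- k) * (- k / t)) (at t)"
    using assms(2) by (simp add: powr_diff mult.commute)
  have "((\<lambda>t. hankel_det \<alpha> (t\<^sup>2) (Suc m) * exp (- t\<^sup>2 / 2) * t powr (- k)) has_real_derivative
     (D * - S * (2 * t) * exp (- t\<^sup>2 / 2) + exp (- t\<^sup>2 / 2) * - t * D) * t powr (- k) +
     t powr (- k) * (- k / t) * (D * exp (- t\<^sup>2 / 2))) (at t)"
    using DERIV_mult[OF DERIV_mult[OF 1 2] 3] by (simp add: D_def)
  also have "(D * - S * (2 * t) * exp (- t\<^sup>2 / 2) + exp (- t\<^sup>2 / 2) * - t * D) * t powr (- k) +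
     t powr (- k) * (- k / t) * (D * exp (- t\<^sup>2 / 2)) =
     hankel_tau \<alpha> (Suc m) t * (- S * (2 * t) - t - k / t)"
  proof -
    have "hankel_tau \<alpha> (Suc m) t = D * exp (- t\<^sup>2 / 2) * t powr (- k)"
      by (simp add: hankel_tau_def D_def k_def n_def del: of_nat_Suc)
    then show ?thesis by (simp add: algebra_simps)
  qed
  \<comment> \<open>\<open>- S * t\<^sup>2\<close> is s d ln D_n / ds, and the factor 2 / t comes
    from s = t^2; the power factor lowers 2 k / t to k / t.\<close>
  also have "- S * (2 * t) - t - k / t = log_tau_deriv \<alpha> m t"
  proof -
    have "- S * (2 * t) = 2 * (- S * t\<^sup>2) / t" using assms(2) by (simp add: power2_eq_square)
    also have "\<dots> = 2 * t * pq m + 2 * (k - h (Suc m) / h m) / t"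
      unfolding S using assms(2) by (simp add: add_divide_distrib diff_divide_distrib power2_eq_square algebra_simps)
    finally show ?thesis
      unfolding log_tau_deriv_def Let_def N_def[symmetric] P_def[symmetric] n_def[symmetric] k_def[symmetric]
      by (simp add: add_divide_distrib diff_divide_distrib)
  qed
  finally show ?thesis
    by (simp add: hankel_tau_def[abs_def] k_def n_def del: of_nat_Suc)
qed

text \<open>Formal solutions exist for every t > 0 by \<open>trace_A\<close>, so tau functions exist
  at all and the uniqueness statement has content.\<close>

lemma hankel_tau_is_tau:
  assumes "\<alpha> > 0" "n = Suc m"
  shows "is_tau_function \<alpha> n (\<lambda>t. of_real (hankel_tau \<alpha> n t))"
  unfolding is_tau_function_def
proof (intro allI impI conjI)
  fix t :: real assume t: "t > 0"
  show "complex_of_real (hankel_tau \<alpha> n t) \<noteq> 0"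
    using hankel_tau_pos[OF assms(1) t, of n] by simp
  obtain \<Phi>inf R \<Phi>0 where sol: "formal_solution_inf \<alpha> n t \<Phi>inf" "formal_solution_zero \<alpha> n t R \<Phi>0"
    using formal_solutions_exist[of t \<alpha> n] omega_fun_nz[OF assms(1) t, of m] trace_A[OF assms(1) t, of m] t assms(2)
    by auto
  have "((\<lambda>t. complex_of_real (hankel_tau \<alpha> n t)) has_vector_derivative
      of_real (hankel_tau \<alpha> n t * log_tau_deriv \<alpha> m t)) (at t)"
    unfolding assms(2) by (intro has_vector_derivative_of_real hankel_tau_derivative assms(1) t)
  then have "((\<lambda>t. complex_of_real (hankel_tau \<alpha> n t)) has_vector_derivative
      of_real (hankel_tau \<alpha> n t) * jmu_form_coeff \<Phi>0 \<Phi>inf) (at t)"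
    using jmu_form_coeff_eq_log_tau_deriv[OF assms(1) t sol[unfolded assms(2)]] by simp
  then show "\<exists>\<Phi>inf R \<Phi>0. formal_solution_inf \<alpha> n t \<Phi>inf \<and> formal_solution_zero \<alpha> n t R \<Phi>0 \<and>
     ((\<lambda>t. complex_of_real (hankel_tau \<alpha> n t)) has_vector_derivative
      of_real (hankel_tau \<alpha> n t) * jmu_form_coeff \<Phi>0 \<Phi>inf) (at t)"
    using sol by blast
qed

text \<open>The tau form has the same value for all formal solutions, whatever their choice at each
  t, so tau divided by \<open>hankel_tau\<close> has zero derivative on the half-line. The resulting
  constant is nonzero since tau has no zeros.\<close>

lemma is_tau_function_unique:
  assumes "\<alpha> > 0" "n = Suc m" and \<tau>: "is_tau_function \<alpha> n \<tau>"
  shows "\<exists>C. \<forall>t>0. of_real (hankel_tau \<alpha> n t) = C * \<tau> t"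
proof -
  have deriv: "(\<tau> has_vector_derivative \<tau> t * of_real (log_tau_deriv \<alpha> m t)) (at t)" if t: "t > 0" for t
  proof -
    obtain \<Phi>inf R \<Phi>0 where sol: "formal_solution_inf \<alpha> n t \<Phi>inf" "formal_solution_zero \<alpha> n t R \<Phi>0"
      and "(\<tau> has_vector_derivative \<tau> t * jmu_form_coeff \<Phi>0 \<Phi>inf) (at t)"
      using \<tau> t unfolding is_tau_function_def by blast
    then show ?thesis
      using jmu_form_coeff_eq_log_tau_deriv[OF assms(1) t sol[unfolded assms(2)]] by simp
  qed
  have "((\<lambda>t. \<tau> t * of_real (inverse (hankel_tau \<alpha> n t))) has_vector_derivative 0) (at t within {0<..})"
    if t: "t \<in> {0<..}" for t
  proof -
    have t: "t > 0" using that by simp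
    define T where "T = hankel_tau \<alpha> n t"
    define g where "g = log_tau_deriv \<alpha> m t"
    have T: "T \<noteq> 0" using hankel_tau_pos[OF assms(1) t, of n] by (simp add: T_def)
    have "(hankel_tau \<alpha> n has_real_derivative T * g) (at t)"
      unfolding T_def g_def assms(2) by (rule hankel_tau_derivative[OF assms(1) t])
    then have "((\<lambda>t. inverse (hankel_tau \<alpha> n t)) has_real_derivative - (inverse T * (T * g) * inverse T)) (at t)"
      using T unfolding T_def by (rule DERIV_inverse')
    then have "((\<lambda>t. inverse (hankel_tau \<alpha> n t)) has_real_derivative - g * inverse T) (at t)"
    proof -
      have "- (inverse T * (T * g) * inverse T) = - g * inverse T" using T by simp
      then show ?thesis using \<open>(_ has_real_derivative - (inverse T * (T * g) * inverse T)) (at t)\<close> by (simp only:)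
    qed
    then have "((\<lambda>t. \<tau> t * of_real (inverse (hankel_tau \<alpha> n t))) has_vector_derivative
        \<tau> t * of_real (- g * inverse T) + \<tau> t * of_real g * of_real (inverse T)) (at t)"
      using deriv[OF t] unfolding T_def g_def
      by (intro has_vector_derivative_mult has_vector_derivative_of_real)
    then have "((\<lambda>t. \<tau> t * of_real (inverse (hankel_tau \<alpha> n t))) has_vector_derivative 0) (at t)"
      by (simp add: algebra_simps)
    then show ?thesis by (rule has_vector_derivative_at_within)
  qed
  then obtain c where c: "\<And>t. t \<in> {0<..} \<Longrightarrow> \<tau> t * of_real (inverse (hankel_tau \<alpha> n t)) = c"
    using has_vector_derivative_zero_constant[of "{0<..}" "\<lambda>t. \<tau> t * of_real (inverse (hankel_tau \<alpha> n t))"]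
    by (auto simp: convex_real_interval)
  have "of_real (hankel_tau \<alpha> n t) = (1 / c) * \<tau> t" if t: "t > 0" for t
  proof -
    have "\<tau> t \<noteq> 0" using \<tau> t by (simp add: is_tau_function_def)
    moreover have "hankel_tau \<alpha> n t \<noteq> 0" using hankel_tau_pos[OF assms(1) t, of n] by simp
    moreover have "\<tau> t * of_real (inverse (hankel_tau \<alpha> n t)) = c" using c t by simp
    ultimately show ?thesis by (auto simp: field_simps)
  qed
  then show ?thesis by blast
qed

theorem mainTheorem5:
  fixes \<alpha> :: real and n :: nat
  assumes "\<alpha> > 0" and "n \<ge> 1"
  shows "(\<exists>\<tau>. is_tau_function \<alpha> n \<tau>) \<and>
    (\<forall>\<tau>. is_tau_function \<alpha> n \<tau> \<longrightarrow>
      (\<exists>C :: complex. \<forall>s>0.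
         of_real (hankel_det \<alpha> s n) =
           C * \<tau> (sqrt s) * of_real (exp (s / 2) * s powr (real n * (real n + \<alpha>) / 2))))"
proof -
  obtain m where n: "n = Suc m" using assms(2) by (cases n) auto
  have D: "hankel_det \<alpha> s n = hankel_tau \<alpha> n (sqrt s) * (exp (s / 2) * s powr (real n * (real n + \<alpha>) / 2))"
    if "s > 0" for s
  proof -
    define k where "k = real n * (real n + \<alpha>)"
    have "sqrt s powr (- k) = s powr (- k / 2)"
      using that by (simp add: powr_half_sqrt[symmetric] powr_powr)
    then have "hankel_tau \<alpha> n (sqrt s) * (exp (s / 2) * s powr (k / 2)) =
        hankel_det \<alpha> s n * (exp (- s / 2) * exp (s / 2)) * (s powr (- k / 2) * s powr (k / 2))"
      using that by (simp add: hankel_tau_def flip: k_def)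
    also have "\<dots> = hankel_det \<alpha> s n"
      using that by (simp flip: exp_add powr_add)
    finally show ?thesis by (simp add: k_def)
  qed
  show ?thesis
  proof (intro conjI allI impI)
    show "\<exists>\<tau>. is_tau_function \<alpha> n \<tau>" using hankel_tau_is_tau[OF assms(1) n] by blast
    fix \<tau> assume "is_tau_function \<alpha> n \<tau>"
    then obtain C where C: "\<And>t. t > 0 \<Longrightarrow> of_real (hankel_tau \<alpha> n t) = C * \<tau> t"
      using is_tau_function_unique[OF assms(1) n] by blast
    show "\<exists>C :: complex. \<forall>s>0. of_real (hankel_det \<alpha> s n) =
           C * \<tau> (sqrt s) * of_real (exp (s / 2) * s powr (real n * (real n + \<alpha>) / 2))"
      by (intro exI[of _ C]) (simp add: D C[symmetric])
  qed
qed

end
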